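(* Let $I_2>I_1>I_3$. The energy with rotor on is $E_2=\frac12(1+\rho\hat\rho)$ starting at $\mathbf{L}=(l,0,0)$, and the highest point on that orbit is $\mathbf{L}=l(0,-\sin\tilde\theta_{max},\cos\tilde\theta_{max})$ where \[ -\sqrt{1-s_+^2}=-\cos\theta_{max}=\sin\tilde\theta_{max}=\frac{\hat\rho-\sqrt{\hat\rho^2+\gamma(\gamma-\delta)}}{\gamma-\delta}. \] The time $T_2$ to move along this orbit segment is given by \[ \gamma\hat T_2=\frac{1}{k\sqrt{s_-^2(1-\nu)+\nu}}\,K(k^2), \] where \[ k^2=\frac{(s_-^{-2}-1)\,(s_-^2(1-\nu)+\nu)}{(2-s_-^2)(1-\nu)},\qquad \nu=\frac{\delta}{\gamma}. \]
   Context: A rigid body with principal moments of inertia $I_1,I_2,I_3$ carries a rotor which, when on, produces the constant internal angular momentum $\mathbf{A}=(0,h,0)^t$ in the body frame. The total angular momentum has constant magnitude $l$. Put $\delta=I_1/I_2-1$, $\gamma=I_1/I_3-1$, $\rho=h/l$, $\hat\rho=\rho(1+\delta)$; the dimensionless time is $\tau=tl/I_1$ and $\hat T_2=lT_2/I_1$. The body-frame angular momentum $\mathbf{L}$ satisfies $\dot{\mathbf{L}}=\mathbf{L}\times\mathbf{\Omega}$ with $\mathbf{\Omega}=\mathrm{diag}(I_1,I_2,I_3)^{-1}(\mathbf{L}-\mathbf{A})$, and the dimensionless conserved energy is $E=\frac{I_1}{2l^2}(\mathbf{L}-\mathbf{A})^t\,\mathrm{diag}(I_1,I_2,I_3)^{-1}(\mathbf{L}-\mathbf{A})$.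 Two parametrisations are used: $\mathbf{L}=l(\cos\theta\cos\psi,-\cos\theta\sin\psi,\sin\theta)$, where $\theta$ is the tilt and $\psi$ the twist angle, and $\mathbf{L}=l(\cos\tilde\theta\cos\tilde\psi,-\sin\tilde\theta,\cos\tilde\theta\sin\tilde\psi)$. The orbit segment meant is that from $(l,0,0)$ (where $\tilde\theta=\tilde\psi=0$) to the highest point, i.e. the point of maximal tilt $\theta_{max}$ (where $\tilde\psi=\pi/2$). Here $s_+=\sin\theta_{max}$, and $s_-=\sin\theta_{min}$ is the sine of the minimal tilt in the subsequent rotor-off twisting motion, whose maximal tilt is $\theta_{max}$; they are related by $s_+^2+(1-s_+^2)\nu=s_-^2$. $K(k^2)=\int_0^{\pi/2}\frac{d\alpha}{\sqrt{1-k^2\sin^2\alpha}}$ is the complete elliptic integral of the first kind.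
   Formalization: The printed prefactor 1/(k√(s₋²(1-ν)+ν)) is false unless 2k²=1; it is corrected to 2k/√(s₋²(1-ν)+ν), same k². h>0 is assumed (h≤0 contradicts the claim); s₋²(1-ν)+ν≠0 is required in the time formula (complex roots if negative); T₂ is the unoriented duration. *)

theory Defs
  imports "HOL-Analysis.Analysis"
begin

definition rotor_momentum :: "real \<Rightarrow> real^3" where
  "rotor_momentum h = vector [0, h, 0]"

text \<open>The action of the inverse of the inertia tensor diag(I1, I2, I3).\<close>

definition inv_inertia :: "real \<Rightarrow> real \<Rightarrow> real \<Rightarrow> real^3 \<Rightarrow> real^3" where
  "inv_inertia I1 I2 I3 v = vector [v $ 1 / I1, v $ 2 / I2, v $ 3 / I3]"

definition angular_velocity :: "real \<Rightarrow> real \<Rightarrow> real \<Rightarrow> real \<Rightarrow> real^3 \<Rightarrow> real^3" where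
  "angular_velocity I1 I2 I3 h v = inv_inertia I1 I2 I3 (v - rotor_momentum h)"

text \<open>Complete motions (all times, in the original time t) of the body-frame angular momentum;
  the rotor is off when h = 0.\<close>

definition rotor_motion ::
    "real \<Rightarrow> real \<Rightarrow> real \<Rightarrow> real \<Rightarrow> (real \<Rightarrow> real^3) \<Rightarrow> bool" where
  "rotor_motion I1 I2 I3 h L \<longleftrightarrow>
     (\<forall>t. (L has_vector_derivative cross3 (L t) (angular_velocity I1 I2 I3 h (L t))) (at t))"

definition scaled_energy ::
    "real \<Rightarrow> real \<Rightarrow> real \<Rightarrow> real \<Rightarrow> real \<Rightarrow> real^3 \<Rightarrow> real" where
  "scaled_energy I1 I2 I3 h l v =
     I1 / (2 * l\<^sup>2) * ((v - rotor_momentum h) \<bullet> inv_inertia I1 I2 I3 (v - rotor_momentum h))"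

text \<open>The angle \<open>\<theta> \<in> [-pi/2, pi/2]\<close> in
  \<open>v = l (cos \<theta> cos \<psi>, - cos \<theta> sin \<psi>, sin \<theta>)\<close>.\<close>

definition tilt :: "real \<Rightarrow> real^3 \<Rightarrow> real" where
  "tilt l v = arcsin (v $ 3 / l)"

definition tilde_param :: "real \<Rightarrow> real \<Rightarrow> real \<Rightarrow> real^3" where
  "tilde_param l \<theta> \<psi> = l *\<^sub>R vector [cos \<theta> * cos \<psi>, - sin \<theta>, cos \<theta> * sin \<psi>]"

definition highest_point :: "real \<Rightarrow> (real \<Rightarrow> real^3) \<Rightarrow> real^3 \<Rightarrow> bool" where
  "highest_point l L P \<longleftrightarrow> P \<in> range L \<and> (\<forall>t. tilt l (L t) \<le> tilt l P)"

definition minimal_tilt :: "real \<Rightarrow> (real \<Rightarrow> real^3) \<Rightarrow> real \<Rightarrow> bool" where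
  "minimal_tilt l L \<alpha> \<longleftrightarrow> \<alpha> \<in> range (\<lambda>t. tilt l (L t)) \<and> (\<forall>t. \<alpha> \<le> tilt l (L t))"

text \<open>\<open>T\<close> is the time spent on the orbit segment whose end points are \<open>(l, 0, 0)\<close>, where both
  angles of \<open>tilde_param\<close> vanish, and \<open>P\<close>, where the second angle is \<open>pi/2\<close>; in between that angle
  stays in \<open>[0, pi/2]\<close>. The order of \<open>t0\<close> and \<open>t1\<close> is left open: for \<open>h > 0\<close> the third component
  of the angular momentum is decreasing at \<open>(l, 0, 0)\<close>, so that the flow runs through this segment
  from \<open>P\<close> to \<open>(l, 0, 0)\<close>.\<close>

definition segment_time :: "real \<Rightarrow> (real \<Rightarrow> real^3) \<Rightarrow> real^3 \<Rightarrow> real \<Rightarrow> bool" where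
  "segment_time l L P T \<longleftrightarrow>
     (\<exists>t0 t1 \<theta> \<psi>.
        T = \<bar>t1 - t0\<bar> \<and> L t1 = P \<and>
        continuous_on (closed_segment t0 t1) \<theta> \<and> continuous_on (closed_segment t0 t1) \<psi> \<and>
        \<theta> t0 = 0 \<and> \<psi> t0 = 0 \<and> \<psi> t1 = pi / 2 \<and>
        (\<forall>t \<in> closed_segment t0 t1.
           0 \<le> \<psi> t \<and> \<psi> t \<le> pi / 2 \<and> L t = tilde_param l (\<theta> t) (\<psi> t)))"

text \<open>The argument \<open>m\<close> is the parameter, i.e. the square of the modulus; it may be negative.\<close>

definition complete_elliptic_K :: "real \<Rightarrow> real" where
  "complete_elliptic_K m = integral {0..pi / 2} (\<lambda>\<alpha>. 1 / sqrt (1 - m * (sin \<alpha>)\<^sup>2))"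

end

theory Submission
  imports Defs
begin

text \<open>
  Angular momentum is measured in units of \<open>l\<close> and split as \<open>(x, y, z)\<close>. With the rotor on, conservation
  of \<open>x\<^sup>2 + y\<^sup>2 + z\<^sup>2\<close> and of the energy confines the orbit through \<open>(1, 0, 0)\<close> to the curve
  \<open>\<delta> y\<^sup>2 + \<gamma> z\<^sup>2 = 2 \<rho>h y\<close> on the unit sphere. The branch through that point has \<open>y \<ge> 0\<close>, and there \<open>z\<^sup>2\<close>
  increases with \<open>y\<close>, while \<open>x\<^sup>2 \<ge> 0\<close> means \<open>y \<le> b\<close>, where \<open>b\<close> is the positive root of
  \<open>(\<gamma> - \<delta>) b\<^sup>2 + 2 \<rho>h b = \<gamma>\<close>. The highest point is therefore \<open>(0, b, sqrt (1 - b\<^sup>2))\<close>.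

  Since \<open>dy/d\<tau> = - \<gamma> x z\<close>, the time along the segment is the integral of
  \<open>1 / (\<gamma> \<bar>x\<bar> \<bar>z\<bar>)\<close> over \<open>y \<in> [0, b]\<close>. With \<open>y = b u\<close> and \<open>a = (1 - \<nu>) b\<^sup>2\<close> the product
  \<open>x\<^sup>2 z\<^sup>2\<close> is a quartic in \<open>u\<close> with the roots \<open>0\<close>, \<open>1\<close>, \<open>- 1 / a\<close> and a further negative one. The Moebius map
  \<open>u = v / (1 + a (1 - v))\<close> fixes \<open>0\<close> and \<open>1\<close> and moves the root \<open>- 1 / a\<close> to infinity, and \<open>v = sin\<^sup>2 \<phi>\<close> then gives
  the Legendre form with parameter \<open>m = (b\<^sup>2 - a\<^sup>2) / (1 - a\<^sup>2)\<close>. The proof uses this substitution in the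
  opposite direction: the lemmas \<open>X_deriv\<close>, \<open>Y_deriv\<close> and \<open>Z_deriv\<close> show that the closed curve
  \<open>\<phi> \<mapsto> (X \<phi>, Y \<phi>, Z \<phi>)\<close> is tangent to the flow, so that the curve, run through with the phase speed
  \<open>d\<phi>/d\<tau> = - \<kappa> sqrt (1 - m sin\<^sup>2 \<phi>)\<close>, is a rotor motion. By uniqueness it is the given one
  (\<open>motion_by_phase\<close>). Every question about the orbit becomes one about the phase: the start is \<open>\<phi> = 0\<close>,
  the highest point \<open>\<phi> = pi / 2\<close> (both modulo \<open>2 pi\<close>), and the time between them is
  \<open>complete_elliptic_K m / \<kappa>\<close>.

  With the rotor off, a motion that starts at the highest point has its minimal tilt where it crosses
  \<open>y = 0\<close>, and conservation of energy gives \<open>sin\<^sup>2 \<theta>min = 1 - a\<close> (\<open>minimal_tilt_rotor_off\<close>). Written in terms of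
  \<open>s\<^sup>2 = 1 - a\<close>, the parameter \<open>m\<close> is \<open>k2\<close>, and \<open>k2 = w b\<^sup>2 / (1 - a\<^sup>2)\<close>. Hence the prefactor
  \<open>\<gamma> / \<kappa> = 2 b / sqrt (1 - a\<^sup>2)\<close> is twice \<open>k / sqrt w\<close>. Both \<open>k\<close> and \<open>sqrt w\<close> are
  imaginary when \<open>w < 0\<close>, but their quotient is always real and positive.
\<close>

section \<open>Facts of real and complex analysis\<close>

lemma ivt_closed_segment:
  fixes f :: "real \<Rightarrow> real"
  assumes "continuous_on (closed_segment s t) f" and "f s \<le> y \<and> y \<le> f t \<or> f t \<le> y \<and> y \<le> f s"
  obtains x where "x \<in> closed_segment s t" "f x = y"
proof -
  have "connected (f ` closed_segment s t)"
    by (rule connected_continuous_image[OF assms(1) connected_segment(1)])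
  moreover have "f s \<in> f ` closed_segment s t" "f t \<in> f ` closed_segment s t" by auto
  ultimately have "{f s..f t} \<subseteq> f ` closed_segment s t" "{f t..f s} \<subseteq> f ` closed_segment s t"
    using connected_contains_Icc by blast+
  hence "y \<in> f ` closed_segment s t" using assms(2) by auto
  thus thesis using that by blast
qed

text \<open>For \<open>w < 0\<close> both roots lie on the nonnegative imaginary axis, so that pulling out a nonnegative
  factor does not cross the branch cut.\<close>

lemma csqrt_of_real_mult_nonneg:
  assumes "0 \<le> e"
  shows "csqrt (complex_of_real (w * e)) = csqrt (complex_of_real w) * sqrt e"
proof (cases "0 \<le> w")
  case True
  thus ?thesis using assms by (simp add: csqrt_of_real_nonneg real_sqrt_mult del: of_real_mult) simp
next
  case False
  hence w: "w \<le> 0" "w * e \<le> 0" using assms by (simp_all add: mult_nonpos_nonneg)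
  have "sqrt \<bar>w * e\<bar> = sqrt \<bar>w\<bar> * sqrt e" using assms by (simp add: abs_mult real_sqrt_mult)
  thus ?thesis
    using w by (simp add: csqrt_of_real_nonpos del: of_real_mult) simp
qed

text \<open>Separation of variables: \<open>B\<close>, the time at which a value is reached, is an antiderivative of
  \<open>1 / f\<close>. The upper bound on \<open>f\<close> makes \<open>B\<close> grow at least linearly in both directions, hence surjective, and
  its inverse \<open>A\<close> is a solution for all times.\<close>

lemma scalar_autonomous_flow:
  fixes f :: "real \<Rightarrow> real"
  assumes cont: "\<And>x. isCont f x" and pos: "\<And>x. 0 < f x" and bound: "\<And>x. f x \<le> M"
  obtains A B :: "real \<Rightarrow> real"
  where "A 0 = 0"
    and "\<And>t. (A has_real_derivative f (A t)) (at t)"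
    and "\<And>x. (B has_real_derivative 1 / f x) (at x)"
    and "\<And>x. A (B x) = x" and "\<And>t. B (A t) = t"
proof -
  have cont_inv: "isCont (\<lambda>x. 1 / f x) x" for x
    using cont pos[of x] by (intro continuous_intros) auto
  obtain F where F: "\<And>x. (F has_vector_derivative 1 / f x) (at x)"
    using einterval_antiderivative[of "-\<infinity>" "\<infinity>" "\<lambda>x. 1 / f x"] cont_inv by auto
  define B where "B x = F x - F 0" for x
  have B_deriv: "(B has_real_derivative 1 / f x) (at x)" for x
    using F[of x] unfolding B_def has_real_derivative_iff_has_vector_derivative[symmetric]
    by (auto intro!: derivative_eq_intros)
  have B_less: "B x < B y" if "x < y" for x y
    using that pos by (intro DERIV_pos_imp_increasing[OF that]) (blast intro: B_deriv divide_pos_pos zero_less_one)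
  have B_cont: "isCont B x" for x using B_deriv DERIV_isCont by blast
  have M_pos: "0 < M" using pos[of 0] bound[of 0] by linarith
  have growth: "B x - x / M \<le> B y - y / M" if "x \<le> y" for x y
  proof (rule DERIV_nonneg_imp_nondecreasing[OF that])
    fix z
    have "1 / M \<le> 1 / f z" using pos[of z] bound[of z] by (intro divide_left_mono) auto
    moreover have "((\<lambda>z. B z - z / M) has_real_derivative 1 / f z - 1 / M) (at z)"
      using B_deriv M_pos by (auto intro!: derivative_eq_intros)
    ultimately show "\<exists>d. ((\<lambda>z. B z - z / M) has_real_derivative d) (at z) \<and> 0 \<le> d" by auto
  qed
  have B0: "B 0 = 0" by (simp add: B_def)
  have surj: "\<exists>x. B x = t" for t
  proof -
    let ?r = "\<bar>t\<bar> * M"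
    have r: "0 \<le> ?r" using M_pos by simp
    have "B (- ?r) \<le> t" using growth[of "- ?r" 0] r M_pos B0 by (simp add: field_simps)
    moreover have "t \<le> B ?r" using growth[of 0 "?r"] r M_pos B0 by (simp add: field_simps)
    ultimately show ?thesis
      using IVT[of B "- ?r" t ?r] r B_cont by auto
  qed
  define A where "A = inv B"
  have inj: "inj B" using B_less by (metis injI linorder_neqE_linordered_idom order_less_irrefl)
  have BA: "B (A t) = t" for t unfolding A_def using surj[of t] by (auto intro: f_inv_into_f)
  have AB: "A (B x) = x" for x unfolding A_def using inj by simp
  have A_cont: "isCont A t" for t
  proof -
    have "isCont A (B (A t))"
      by (rule isCont_inverse_function2[of "A t - 1" _ "A t + 1"]) (auto simp: AB B_cont)
    thus ?thesis by (simp add: BA)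
  qed
  have "(A has_real_derivative inverse (1 / f (A t))) (at t)" for t
    by (rule DERIV_inverse_function[where f = B and a = "t - 1" and b = "t + 1"])
      (use B_deriv BA A_cont pos[of "A t"] in auto)
  hence "(A has_real_derivative f (A t)) (at t)" for t by simp
  moreover have "A 0 = 0" using AB[of 0] B0 by simp
  ultimately show thesis using that B_deriv AB BA by blast
qed

text \<open>Gronwall: the squared distance of two solutions grows at most with the rate \<open>2 K\<close>, so that its
  product with \<open>exp (- 2 K t)\<close> cannot increase from its initial value zero.\<close>

lemma lipschitz_ode_unique_forward:
  fixes u v :: "real \<Rightarrow> 'a::real_inner"
  assumes u: "\<And>t. (u has_vector_derivative f (u t)) (at t)"
    and v: "\<And>t. (v has_vector_derivative f (v t)) (at t)"
    and S: "\<And>t. u t \<in> S" "\<And>t. v t \<in> S"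
    and lip: "\<And>x y. x \<in> S \<Longrightarrow> y \<in> S \<Longrightarrow> norm (f x - f y) \<le> K * norm (x - y)"
    and "u 0 = v 0" and "0 \<le> t"
  shows "u t = v t"
proof -
  define w where "w t = u t - v t" for t
  let ?E = "\<lambda>t. (w t \<bullet> w t) * exp (- 2 * K * t)"
  have "?E t \<le> ?E 0"
  proof (rule DERIV_nonpos_imp_nonincreasing[OF \<open>0 \<le> t\<close>])
    fix s
    define g where "g = f (u s) - f (v s)"
    have "(w has_vector_derivative g) (at s)"
      unfolding w_def g_def using u v by (rule has_vector_derivative_diff)
    hence d: "(w has_derivative (\<lambda>x. x *\<^sub>R g)) (at s)"
      by (simp add: has_vector_derivative_def)
    have "((\<lambda>t. w t \<bullet> w t) has_derivative (*) (2 * (w s \<bullet> g))) (at s)"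
      by (rule has_derivative_eq_rhs[OF has_derivative_inner[OF d d]])
        (simp add: fun_eq_iff inner_commute algebra_simps)
    hence w_deriv: "((\<lambda>t. w t \<bullet> w t) has_real_derivative 2 * (w s \<bullet> g)) (at s)"
      by (simp add: has_field_derivative_def)
    have "(?E has_real_derivative 2 * exp (- 2 * K * s) * (w s \<bullet> g - K * (w s \<bullet> w s))) (at s)"
      by (rule derivative_eq_intros w_deriv refl)+ (simp add: algebra_simps)
    moreover have "w s \<bullet> g \<le> K * (w s \<bullet> w s)"
    proof -
      have "w s \<bullet> g \<le> norm (w s) * norm g" by (rule norm_cauchy_schwarz)
      also have "\<dots> \<le> norm (w s) * (K * norm (w s))"
        unfolding w_def g_def using lip S by (intro mult_left_mono) auto
      also have "\<dots> = K * (w s \<bullet> w s)"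
        by (simp add: power2_norm_eq_inner[symmetric] power2_eq_square)
      finally show ?thesis .
    qed
    ultimately show "\<exists>d. (?E has_real_derivative d) (at s) \<and> d \<le> 0"
      by (intro exI conjI) (assumption, auto intro!: mult_nonneg_nonpos)
  qed
  hence "w t \<bullet> w t \<le> 0" using \<open>u 0 = v 0\<close> by (simp add: w_def mult_le_0_iff)
  hence "w t = 0" using inner_ge_zero[of "w t"] by (metis inner_eq_zero_iff order_antisym)
  thus ?thesis by (simp add: w_def)
qed

text \<open>Negative times are reduced to positive ones by reversing time, which replaces \<open>f\<close> by \<open>- f\<close>.\<close>

lemma lipschitz_ode_unique:
  fixes u v :: "real \<Rightarrow> 'a::real_inner"
  assumes u: "\<And>t. (u has_vector_derivative f (u t)) (at t)"
    and v: "\<And>t. (v has_vector_derivative f (v t)) (at t)"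
    and S: "\<And>t. u t \<in> S" "\<And>t. v t \<in> S"
    and lip: "\<And>x y. x \<in> S \<Longrightarrow> y \<in> S \<Longrightarrow> norm (f x - f y) \<le> K * norm (x - y)"
    and init: "u 0 = v 0"
  shows "u t = v t"
proof (cases "0 \<le> t")
  case True
  thus ?thesis using lipschitz_ode_unique_forward[OF u v S lip init] by blast
next
  case False
  have reversed: "((\<lambda>t. w (- t)) has_vector_derivative - f (w (- t))) (at t)"
    if "\<And>t. (w has_vector_derivative f (w t)) (at t)" for w t
  proof -
    have "(uminus has_vector_derivative - 1) (at t)"
      by (auto intro!: derivative_eq_intros)
    from vector_diff_chain_at[OF this that] show ?thesis by (simp add: o_def)
  qed
  have lip': "norm (- f x - - f y) \<le> K * norm (x - y)" if "x \<in> S" "y \<in> S" for x y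
    using lip[OF that] by (simp add: norm_minus_commute)
  have "u (- (- t)) = v (- (- t))"
  proof (rule lipschitz_ode_unique_forward[where f = "\<lambda>x. - f x" and u = "\<lambda>t. u (- t)" and v = "\<lambda>t. v (- t)"])
    show "((\<lambda>t. u (- t)) has_vector_derivative - f (u (- t))) (at t)" for t by (rule reversed[OF u])
    show "((\<lambda>t. v (- t)) has_vector_derivative - f (v (- t))) (at t)" for t by (rule reversed[OF v])
  qed (use False init S lip' in simp_all)
  thus ?thesis by simp
qed

section \<open>Conservation laws and uniqueness of rotor motions\<close>

lemma rotor_motion_derivs:
  assumes "rotor_motion I1 I2 I3 h L"
  shows "((\<lambda>t. L t $ 1) has_real_derivative
            L t $ 2 * (L t $ 3 / I3) - L t $ 3 * ((L t $ 2 - h) / I2)) (at t)"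
    and "((\<lambda>t. L t $ 2) has_real_derivative
            L t $ 3 * (L t $ 1 / I1) - L t $ 1 * (L t $ 3 / I3)) (at t)"
    and "((\<lambda>t. L t $ 3) has_real_derivative
            L t $ 1 * ((L t $ 2 - h) / I2) - L t $ 2 * (L t $ 1 / I1)) (at t)"
proof -
  let ?v = "cross3 (L t) (angular_velocity I1 I2 I3 h (L t))"
  have "(L has_vector_derivative ?v) (at t)" using assms by (simp add: rotor_motion_def)
  hence "((\<lambda>t. L t $ i) has_real_derivative ?v $ i) (at t)" for i
    unfolding has_real_derivative_iff_has_vector_derivative
    using bounded_linear.has_vector_derivative[OF bounded_linear_vec_nth] by blast
  from this[of 1] this[of 2] this[of 3]
  show "((\<lambda>t. L t $ 1) has_real_derivative
            L t $ 2 * (L t $ 3 / I3) - L t $ 3 * ((L t $ 2 - h) / I2)) (at t)"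
    and "((\<lambda>t. L t $ 2) has_real_derivative
            L t $ 3 * (L t $ 1 / I1) - L t $ 1 * (L t $ 3 / I3)) (at t)"
    and "((\<lambda>t. L t $ 3) has_real_derivative
            L t $ 1 * ((L t $ 2 - h) / I2) - L t $ 2 * (L t $ 1 / I1)) (at t)"
    by (simp_all add: cross3_def angular_velocity_def inv_inertia_def rotor_momentum_def)
qed

lemma rotor_motionI:
  assumes "\<And>t. ((\<lambda>t. L t $ 1) has_real_derivative
            L t $ 2 * (L t $ 3 / I3) - L t $ 3 * ((L t $ 2 - h) / I2)) (at t)"
    and "\<And>t. ((\<lambda>t. L t $ 2) has_real_derivative
            L t $ 3 * (L t $ 1 / I1) - L t $ 1 * (L t $ 3 / I3)) (at t)"
    and "\<And>t. ((\<lambda>t. L t $ 3) has_real_derivative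
            L t $ 1 * ((L t $ 2 - h) / I2) - L t $ 2 * (L t $ 1 / I1)) (at t)"
  shows "rotor_motion I1 I2 I3 h L"
  unfolding rotor_motion_def
proof
  fix t
  let ?v = "cross3 (L t) (angular_velocity I1 I2 I3 h (L t))"
  have v: "?v $ 1 = L t $ 2 * (L t $ 3 / I3) - L t $ 3 * ((L t $ 2 - h) / I2)"
    "?v $ 2 = L t $ 3 * (L t $ 1 / I1) - L t $ 1 * (L t $ 3 / I3)"
    "?v $ 3 = L t $ 1 * ((L t $ 2 - h) / I2) - L t $ 2 * (L t $ 1 / I1)"
    by (simp_all add: cross3_def angular_velocity_def inv_inertia_def rotor_momentum_def)
  have comp: "((\<lambda>t. L t $ i) has_real_derivative ?v $ i) (at t)" for i
    using exhaust_3[of i] assms[of t] by (auto simp only: v)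
  show "(L has_vector_derivative ?v) (at t)"
    unfolding has_vector_derivative_def
    by (rule iffD2[OF has_derivative_componentwise_within])
      (use comp in \<open>auto simp: Basis_vec_def inner_axis has_field_derivative_def mult_commute_abs\<close>)
qed

lemma rotor_motion_norm:
  assumes "rotor_motion I1 I2 I3 h L"
  shows "(L t $ 1)\<^sup>2 + (L t $ 2)\<^sup>2 + (L t $ 3)\<^sup>2 = (L 0 $ 1)\<^sup>2 + (L 0 $ 2)\<^sup>2 + (L 0 $ 3)\<^sup>2"
proof -
  have "\<forall>t. ((\<lambda>t. (L t $ 1)\<^sup>2 + (L t $ 2)\<^sup>2 + (L t $ 3)\<^sup>2) has_real_derivative 0) (at t)"
    by (auto intro!: derivative_eq_intros rotor_motion_derivs[OF assms] simp: algebra_simps)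
  thus ?thesis by (rule DERIV_isconst_all)
qed

lemma rotor_motion_energy:
  assumes "rotor_motion I1 I2 I3 h L"
  shows "(L t $ 1)\<^sup>2 / I1 + (L t $ 2 - h)\<^sup>2 / I2 + (L t $ 3)\<^sup>2 / I3
       = (L 0 $ 1)\<^sup>2 / I1 + (L 0 $ 2 - h)\<^sup>2 / I2 + (L 0 $ 3)\<^sup>2 / I3"
proof -
  have "\<forall>t. ((\<lambda>t. (L t $ 1)\<^sup>2 / I1 + (L t $ 2 - h)\<^sup>2 / I2 + (L t $ 3)\<^sup>2 / I3)
      has_real_derivative 0) (at t)"
    by (auto intro!: derivative_eq_intros rotor_motion_derivs[OF assms]
        simp: divide_inverse algebra_simps)
  thus ?thesis by (rule DERIV_isconst_all)
qed

text \<open>The vector field is quadratic and thus not globally Lipschitz, but both motions stay on one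
  sphere, where it is.\<close>

lemma rotor_motion_unique:
  assumes L: "rotor_motion I1 I2 I3 h L" and M: "rotor_motion I1 I2 I3 h M"
    and init: "L 0 = M 0"
  shows "L t = M t"
proof -
  let ?W = "angular_velocity I1 I2 I3 h"
  define r where "r = norm (L 0)"
  have norm_eq: "norm v = sqrt ((v $ 1)\<^sup>2 + (v $ 2)\<^sup>2 + (v $ 3)\<^sup>2)" for v :: "real^3"
    by (simp add: norm_vec_def L2_set_def sum_3)
  have on_sphere: "norm (L t) = r" "norm (M t) = r" for t
    using rotor_motion_norm[OF L, of t] rotor_motion_norm[OF M, of t] init
    by (simp_all add: norm_eq r_def)
  have cross_le: "norm (cross3 v w) \<le> norm v * norm w" for v w
  proof (rule power2_le_imp_le)
    show "(norm (cross3 v w))\<^sup>2 \<le> (norm v * norm w)\<^sup>2"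
      using norm_cross_dot[of v w] zero_le_power2[of "v \<bullet> w"] by linarith
  qed simp
  have "linear (inv_inertia I1 I2 I3)"
    by (rule linearI) (auto simp: inv_inertia_def vec_eq_iff forall_3 add_divide_distrib)
  hence bl: "bounded_linear (inv_inertia I1 I2 I3)" by (rule linear_conv_bounded_linear[THEN iffD1])
  then obtain K where K: "0 < K" "\<And>v. norm (inv_inertia I1 I2 I3 v) \<le> norm v * K"
    using bounded_linear.pos_bounded by blast
  have W_diff: "?W v - ?W w = inv_inertia I1 I2 I3 (v - w)" for v w
    by (simp add: angular_velocity_def bounded_linear.linear[OF bl] linear_diff[symmetric])
  define c where "c = (r + norm (rotor_momentum h)) * K + r * K"
  have "norm (cross3 v (?W v) - cross3 w (?W w)) \<le> c * norm (v - w)"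
    if v: "v \<in> sphere 0 r" and w: "w \<in> sphere 0 r" for v w
  proof -
    have "cross3 v (?W v) - cross3 w (?W w) = cross3 (v - w) (?W v) + cross3 w (?W v - ?W w)"
      by (simp add: Cross3.left_diff_distrib Cross3.right_diff_distrib)
    hence "norm (cross3 v (?W v) - cross3 w (?W w))
        \<le> norm (v - w) * norm (?W v) + norm w * norm (?W v - ?W w)"
      by (metis norm_triangle_mono cross_le)
    also have "\<dots> \<le> norm (v - w) * ((r + norm (rotor_momentum h)) * K) + norm w * (norm (v - w) * K)"
    proof (intro add_mono mult_left_mono)
      have "norm (?W v) \<le> norm (v - rotor_momentum h) * K"
        by (simp add: angular_velocity_def K)
      also have "\<dots> \<le> (r + norm (rotor_momentum h)) * K"
        using K v norm_triangle_ineq4[of v "rotor_momentum h"] by (intro mult_right_mono) auto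
      finally show "norm (?W v) \<le> (r + norm (rotor_momentum h)) * K" .
    qed (auto simp: W_diff K)
    also have "\<dots> = c * norm (v - w)" using w by (simp add: c_def algebra_simps)
    finally show ?thesis .
  qed
  note lip = this
  show ?thesis
  proof (rule lipschitz_ode_unique[where f = "\<lambda>v. cross3 v (?W v)" and S = "sphere 0 r"])
    show "L 0 = M 0" by (rule init)
  qed (use L M on_sphere lip in \<open>simp_all add: rotor_motion_def\<close>)
qed

section \<open>The rotor-on orbit as an explicit curve\<close>

locale rotor_body =
  fixes I1 I2 I3 l h \<delta> \<gamma> \<rho> \<rho>h \<nu> :: real
  assumes inertia: "0 < I3" "I3 < I1" "I1 < I2"
    and l_pos: "0 < l" and h_pos: "0 < h"
    and delta: "\<delta> = I1 / I2 - 1" and gamma: "\<gamma> = I1 / I3 - 1"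
    and rho: "\<rho> = h / l" and rho_hat: "\<rho>h = \<rho> * (1 + \<delta>)"
    and nu: "\<nu> = \<delta> / \<gamma>"
begin

text \<open>The constants of the Legendre form: \<open>b\<close> is the largest \<open>y\<close> on the orbit, that is
  \<open>- sin \<theta>tmax = cos \<theta>max\<close>; \<open>a\<close> turns out to be \<open>1 - sin\<^sup>2 \<theta>min\<close>; and \<open>m\<close> is the square of the elliptic modulus.\<close>

definition b where "b = (sqrt (\<rho>h\<^sup>2 + \<gamma> * (\<gamma> - \<delta>)) - \<rho>h) / (\<gamma> - \<delta>)"
definition a where "a = (1 - \<nu>) * b\<^sup>2"
definition m where "m = (b\<^sup>2 - a\<^sup>2) / (1 - a\<^sup>2)"

lemma inertia_pos: "0 < I1" "0 < I2" using inertia by simp_all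

lemma gamma_pos: "0 < \<gamma>" using inertia by (simp add: gamma)
lemma delta_neg: "\<delta> < 0" using inertia inertia_pos by (simp add: delta)
lemma nu_neg: "\<nu> < 0" using gamma_pos delta_neg by (simp add: nu divide_neg_pos)
lemma gamma_nu: "\<gamma> * \<nu> = \<delta>" using gamma_pos by (simp add: nu)
lemma rho_hat_eq: "\<rho>h = h * I1 / (l * I2)" by (simp add: rho_hat rho delta)
lemma rho_hat_pos: "0 < \<rho>h" using h_pos l_pos inertia_pos by (simp add: rho_hat_eq)

lemma b_root: "(\<gamma> - \<delta>) * b\<^sup>2 + 2 * \<rho>h * b = \<gamma>"
proof -
  let ?A = "\<gamma> - \<delta>" and ?R = "sqrt (\<rho>h\<^sup>2 + \<gamma> * (\<gamma> - \<delta>))"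
  have A: "0 < ?A" using gamma_pos delta_neg by simp
  have R: "?R\<^sup>2 = \<rho>h\<^sup>2 + \<gamma> * ?A" using A gamma_pos by simp
  have Ab: "?A * b = ?R - \<rho>h" using A by (simp add: b_def)
  have "?A * (?A * b\<^sup>2 + 2 * \<rho>h * b) = (?A * b + \<rho>h)\<^sup>2 - \<rho>h\<^sup>2"
    by (simp add: power2_eq_square algebra_simps)
  also have "\<dots> = ?A * \<gamma>" unfolding Ab using R by simp
  finally show ?thesis using A by simp
qed

lemma b_pos: "0 < b"
proof -
  have "sqrt (\<rho>h\<^sup>2) < sqrt (\<rho>h\<^sup>2 + \<gamma> * (\<gamma> - \<delta>))"
    using gamma_pos delta_neg by (intro real_sqrt_less_mono) simp
  thus ?thesis using rho_hat_pos gamma_pos delta_neg by (simp add: b_def)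
qed

lemma gamma_a: "\<gamma> * a = (\<gamma> - \<delta>) * b\<^sup>2"
proof -
  have "\<gamma> * a = (\<gamma> - \<gamma> * \<nu>) * b\<^sup>2" by (simp add: a_def algebra_simps)
  thus ?thesis by (simp add: gamma_nu)
qed

text \<open>The left-hand side is the value at the highest point of \<open>\<delta> y\<^sup>2 + \<gamma> z\<^sup>2\<close>, the quadratic form that is conserved
  once the rotor is off; that it is positive is why \<open>a < 1\<close>.\<close>

lemma gamma_1a: "\<gamma> * (1 - a) = 2 * \<rho>h * b"
  using gamma_a b_root by (simp add: right_diff_distrib)

lemma a_pos: "0 < a" using nu_neg b_pos by (simp add: a_def)

lemma a_less_1: "a < 1"
proof -
  have "0 < \<gamma> * (1 - a)" using gamma_1a rho_hat_pos b_pos by simp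
  thus ?thesis using gamma_pos by (simp add: zero_less_mult_iff)
qed

lemma b2_less_a: "b\<^sup>2 < a" using nu_neg b_pos by (simp add: a_def)

lemma b_less_1: "b < 1"
proof -
  have "b\<^sup>2 < 1" using b2_less_a a_less_1 by simp
  thus ?thesis using b_pos by (simp add: power_less_one_iff)
qed

lemma a2_less_1: "a\<^sup>2 < 1" using a_pos a_less_1 by (simp add: power_less_one_iff)

lemma m_eq: "m * (1 - a\<^sup>2) = b\<^sup>2 - a\<^sup>2" using a2_less_1 by (simp add: m_def)

lemma one_minus_m: "(1 - a\<^sup>2) * (1 - m) = 1 - b\<^sup>2"
  using m_eq by (simp add: algebra_simps)

lemma m_less_1: "m < 1"
proof -
  have "0 < (1 - a\<^sup>2) * (1 - m)"
    using one_minus_m b2_less_a a_less_1 by simp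
  thus ?thesis using a2_less_1 by (simp add: zero_less_mult_iff)
qed

text \<open>The curve \<open>(X, Y, Z)\<close> comes from \<open>Y = b u\<close> with \<open>u = v / (1 + a (1 - v))\<close> and \<open>v = sin\<^sup>2 \<phi>\<close>, where
  \<open>X\<^sup>2 = (1 - u) (1 + a u)\<close>. The roots in \<open>X\<close> and \<open>Z\<close> are resolved as \<open>cos \<phi>\<close> and \<open>sin \<phi>\<close>, whose signs
  carry the curve once around the whole orbit. The phase speed in dimensionless time is \<open>- \<kappa> * delta_amp \<phi>\<close>,
  negative because \<open>z\<close> decreases at \<open>(1, 0, 0)\<close>. The factor \<open>delta_amp\<close> is
  Legendre's \<open>\<Delta>\<close>, the root in the integrand of \<open>complete_elliptic_K m\<close>.\<close>

definition delta_amp where "delta_amp \<phi> = sqrt (1 - m * (sin \<phi>)\<^sup>2)"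
definition \<kappa> where "\<kappa> = \<gamma> * sqrt (1 - a\<^sup>2) / (2 * b)"
definition den where "den \<phi> = 1 + a * (cos \<phi>)\<^sup>2"
definition X where "X \<phi> = (1 + a) * cos \<phi> / den \<phi>"
definition Y where "Y \<phi> = b * (sin \<phi>)\<^sup>2 / den \<phi>"
definition Z where "Z \<phi> = sqrt (1 - a\<^sup>2) * sin \<phi> * delta_amp \<phi> / den \<phi>"

lemma radicand_bounds: "min 1 (1 - m) \<le> 1 - m * (sin \<phi>)\<^sup>2" "1 - m * (sin \<phi>)\<^sup>2 \<le> 1 + \<bar>m\<bar>"
proof -
  have s: "0 \<le> (sin \<phi>)\<^sup>2" "(sin \<phi>)\<^sup>2 \<le> 1" by (simp_all add: power_le_one_iff abs_square_le_1)
  show "min 1 (1 - m) \<le> 1 - m * (sin \<phi>)\<^sup>2"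
    using s mult_left_le[of "(sin \<phi>)\<^sup>2" m] mult_nonpos_nonneg[of m "(sin \<phi>)\<^sup>2"]
    by (cases "0 \<le> m") (auto simp: min_le_iff_disj)
  have "\<bar>m\<bar> * (sin \<phi>)\<^sup>2 \<le> \<bar>m\<bar>" using s by (intro mult_left_le) auto
  moreover have "- (m * (sin \<phi>)\<^sup>2) \<le> \<bar>m\<bar> * (sin \<phi>)\<^sup>2"
    using abs_ge_minus_self[of "m * (sin \<phi>)\<^sup>2"] by (simp add: abs_mult)
  ultimately show "1 - m * (sin \<phi>)\<^sup>2 \<le> 1 + \<bar>m\<bar>" by linarith
qed

lemma delta_amp_sq: "(delta_amp \<phi>)\<^sup>2 = 1 - m * (sin \<phi>)\<^sup>2"
  and delta_amp_pos: "0 < delta_amp \<phi>"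
proof -
  have "0 < min 1 (1 - m)" using m_less_1 by simp
  hence "0 < 1 - m * (sin \<phi>)\<^sup>2" using radicand_bounds(1)[of \<phi>] by linarith
  thus "(delta_amp \<phi>)\<^sup>2 = 1 - m * (sin \<phi>)\<^sup>2" "0 < delta_amp \<phi>" by (simp_all add: delta_amp_def)
qed

lemma kappa_pos: "0 < \<kappa>" using gamma_pos a2_less_1 b_pos by (simp add: \<kappa>_def)

lemma den_pos: "0 < den \<phi>"
proof -
  have "0 \<le> a * (cos \<phi>)\<^sup>2" using a_pos by simp
  thus ?thesis by (simp add: den_def)
qed

lemma den_deriv: "(den has_real_derivative - 2 * a * cos \<phi> * sin \<phi>) (at \<phi>)"
  unfolding den_def[abs_def] by (auto intro!: derivative_eq_intros)

lemma delta_amp_deriv: "(delta_amp has_real_derivative - m * sin \<phi> * cos \<phi> / delta_amp \<phi>) (at \<phi>)"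
proof -
  have "0 < 1 - m * (sin \<phi>)\<^sup>2" using delta_amp_pos[of \<phi>] by (simp add: delta_amp_def)
  thus ?thesis unfolding delta_amp_def[abs_def]
    by (auto intro!: derivative_eq_intros simp: field_simps)
qed

text \<open>Tangency to the flow, one lemma per component: the derivative with respect to the phase is the component of the
  dimensionless vector field, divided by the phase speed \<open>- \<kappa> * delta_amp \<phi>\<close>. The component
  \<open>Y\<close> dictates the value of \<open>\<kappa>\<close>. For \<open>X\<close> and \<open>Z\<close>, clearing denominators leaves polynomial identities in
  \<open>sin\<^sup>2 \<phi>\<close>, which follow from the lemmas \<open>gamma_a\<close>, \<open>gamma_1a\<close> and \<open>m_eq\<close>.\<close>

lemma X_deriv: "(X has_real_derivative
    - (Z \<phi> * ((\<gamma> - \<delta>) * Y \<phi> + \<rho>h)) / (\<kappa> * delta_amp \<phi>)) (at \<phi>)"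
proof -
  define s c D q r where "s = sin \<phi>" and "c = cos \<phi>" and "D = den \<phi>"
    and "q = sqrt (1 - a\<^sup>2)" and "r = delta_amp \<phi>"
  note defs = s_def c_def D_def q_def r_def
  have pos: "0 < D" "0 < r" "0 < q" "0 < \<gamma>" "0 < b"
    using den_pos delta_amp_pos a2_less_1 gamma_pos b_pos by (simp_all add: defs)
  have s2: "s\<^sup>2 = 1 - c\<^sup>2" by (simp add: defs sin_squared_eq)
  have D: "D = 1 + a * c\<^sup>2" by (simp add: defs den_def)
  have "(X has_real_derivative ((1 + a) * - s * D - (1 + a) * c * (- 2 * a * c * s)) / (D * D)) (at \<phi>)"
    unfolding X_def[abs_def] using den_pos[of \<phi>]
    by (auto intro!: derivative_eq_intros den_deriv simp: defs)
  moreover have "((1 + a) * - s * D - (1 + a) * c * (- 2 * a * c * s)) / (D * D)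
      = - (Z \<phi> * ((\<gamma> - \<delta>) * Y \<phi> + \<rho>h)) / (\<kappa> * delta_amp \<phi>)"
  proof -
    have "\<gamma> * (1 + a) * (1 - a * c\<^sup>2) = 2 * (\<gamma> * a) * s\<^sup>2 + \<gamma> * (1 - a) * D"
      unfolding s2 D by (simp add: algebra_simps)
    also have "\<dots> = 2 * b * ((\<gamma> - \<delta>) * b * s\<^sup>2 + \<rho>h * D)"
      unfolding gamma_a gamma_1a by (simp add: power2_eq_square algebra_simps)
    finally have key: "\<gamma> * (1 + a) * (1 - a * c\<^sup>2) = 2 * b * ((\<gamma> - \<delta>) * b * s\<^sup>2 + \<rho>h * D)" .
    have "Z \<phi> * ((\<gamma> - \<delta>) * Y \<phi> + \<rho>h) = q * s * r / D * (((\<gamma> - \<delta>) * b * s\<^sup>2 + \<rho>h * D) / D)"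
      using pos by (simp add: Z_def Y_def defs[symmetric] add_divide_distrib)
    also have "(\<gamma> - \<delta>) * b * s\<^sup>2 + \<rho>h * D = \<gamma> * (1 + a) * (1 - a * c\<^sup>2) / (2 * b)"
      using key pos by (simp add: field_simps)
    finally have field: "Z \<phi> * ((\<gamma> - \<delta>) * Y \<phi> + \<rho>h)
        = q * s * r / D * (\<gamma> * (1 + a) * (1 - a * c\<^sup>2) / (2 * b) / D)" .
    have "- (Z \<phi> * ((\<gamma> - \<delta>) * Y \<phi> + \<rho>h)) / (\<kappa> * delta_amp \<phi>)
        = - ((1 + a) * s * (1 - a * c\<^sup>2)) / (D * D)"
      unfolding field using pos by (simp add: \<kappa>_def defs[symmetric] divide_simps)
    also have "(1 + a) * s * (1 - a * c\<^sup>2) = (1 + a) * s * D - (1 + a) * c * (2 * a * c * s)"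
      unfolding D by (simp add: power2_eq_square algebra_simps)
    finally show ?thesis by simp
  qed
  ultimately show ?thesis by simp
qed

lemma Y_deriv: "(Y has_real_derivative \<gamma> * X \<phi> * Z \<phi> / (\<kappa> * delta_amp \<phi>)) (at \<phi>)"
proof -
  define s c D q r where "s = sin \<phi>" and "c = cos \<phi>" and "D = den \<phi>"
    and "q = sqrt (1 - a\<^sup>2)" and "r = delta_amp \<phi>"
  note defs = s_def c_def D_def q_def r_def
  have pos: "0 < D" "0 < r" "0 < q" "0 < \<gamma>" "0 < b"
    using den_pos delta_amp_pos a2_less_1 gamma_pos b_pos by (simp_all add: defs)
  have s2: "s\<^sup>2 = 1 - c\<^sup>2" by (simp add: defs sin_squared_eq)
  have D: "D = 1 + a * c\<^sup>2" by (simp add: defs den_def)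
  have "(Y has_real_derivative (b * (2 * s * c) * D - b * s\<^sup>2 * (- 2 * a * c * s)) / (D * D)) (at \<phi>)"
    unfolding Y_def[abs_def] using den_pos[of \<phi>]
    by (auto intro!: derivative_eq_intros den_deriv simp: defs)
  also have "b * (2 * s * c) * D - b * s\<^sup>2 * (- 2 * a * c * s) = 2 * b * s * c * (1 + a)"
    unfolding s2 D by (simp add: power2_eq_square algebra_simps)
  also have "2 * b * s * c * (1 + a) / (D * D) = \<gamma> * X \<phi> * Z \<phi> / (\<kappa> * delta_amp \<phi>)"
    using pos by (simp add: X_def Z_def \<kappa>_def defs[symmetric] divide_simps)
  finally show ?thesis .
qed

lemma Z_deriv: "(Z has_real_derivative - (X \<phi> * (\<delta> * Y \<phi> - \<rho>h)) / (\<kappa> * delta_amp \<phi>)) (at \<phi>)"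
proof -
  define s c D q r where "s = sin \<phi>" and "c = cos \<phi>" and "D = den \<phi>"
    and "q = sqrt (1 - a\<^sup>2)" and "r = delta_amp \<phi>"
  note defs = s_def c_def D_def q_def r_def
  have pos: "0 < D" "0 < r" "0 < q" "0 < \<gamma>" "0 < b"
    using den_pos delta_amp_pos a2_less_1 gamma_pos b_pos by (simp_all add: defs)
  have c2: "c\<^sup>2 = 1 - s\<^sup>2" by (simp add: defs cos_squared_eq)
  have D: "D = 1 + a * (1 - s\<^sup>2)" by (simp add: defs den_def cos_squared_eq)
  have r2: "r\<^sup>2 = 1 - m * s\<^sup>2" by (simp add: defs delta_amp_sq)
  have q2: "q\<^sup>2 = 1 - a\<^sup>2" using a2_less_1 by (simp add: defs)
  have "(Z has_real_derivative
      ((q * c * r + q * s * (- m * s * c / r)) * D - q * s * r * (- 2 * a * c * s)) / (D * D)) (at \<phi>)"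
    unfolding Z_def[abs_def] using den_pos[of \<phi>]
    by (auto intro!: derivative_eq_intros den_deriv delta_amp_deriv simp: defs)
  also have "(q * c * r + q * s * (- m * s * c / r)) * D - q * s * r * (- 2 * a * c * s)
      = q * c * ((r\<^sup>2 - m * s\<^sup>2) * D + 2 * a * s\<^sup>2 * r\<^sup>2) / r"
    using pos by (simp add: divide_simps) (simp add: power2_eq_square algebra_simps)
  also have "(r\<^sup>2 - m * s\<^sup>2) * D + 2 * a * s\<^sup>2 * r\<^sup>2
      = D + 2 * s\<^sup>2 * (a - m * (1 + a))"
    unfolding r2 D by (simp add: power2_eq_square algebra_simps)
  finally have 1: "(Z has_real_derivative
      q * c * (D + 2 * s\<^sup>2 * (a - m * (1 + a))) / r / (D * D)) (at \<phi>)" .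
  have "\<gamma> * (1 - a) * (D + 2 * s\<^sup>2 * (a - m * (1 + a)))
      = \<gamma> * (1 - a) * D + 2 * s\<^sup>2 * (\<gamma> * (a * (1 - a) - m * (1 - a\<^sup>2)))"
    by (simp add: power2_eq_square algebra_simps)
  also have "a * (1 - a) - m * (1 - a\<^sup>2) = a - b\<^sup>2"
    unfolding m_eq by (simp add: power2_eq_square algebra_simps)
  also have "\<gamma> * (a - b\<^sup>2) = - \<delta> * b\<^sup>2"
    using gamma_a by (simp add: algebra_simps)
  finally have key: "\<gamma> * (1 - a) * (D + 2 * s\<^sup>2 * (a - m * (1 + a)))
      = 2 * b * (\<rho>h * D - \<delta> * b * s\<^sup>2)"
    unfolding gamma_1a by (simp add: power2_eq_square algebra_simps)
  have q2': "(1 + a) * (1 - a) = q\<^sup>2" unfolding q2 by (simp add: power2_eq_square algebra_simps)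
  have "- (X \<phi> * (\<delta> * Y \<phi> - \<rho>h)) = (1 + a) * c / D * ((\<rho>h * D - \<delta> * b * s\<^sup>2) / D)"
    using pos by (simp add: X_def Y_def defs[symmetric] diff_divide_distrib right_diff_distrib)
  also have "\<rho>h * D - \<delta> * b * s\<^sup>2 = \<gamma> * (1 - a) * (D + 2 * s\<^sup>2 * (a - m * (1 + a))) / (2 * b)"
    using key pos by (simp add: field_simps)
  also have "(1 + a) * c / D * (\<gamma> * (1 - a) * (D + 2 * s\<^sup>2 * (a - m * (1 + a))) / (2 * b) / D)
     = ((1 + a) * (1 - a)) * (c * \<gamma> * (D + 2 * s\<^sup>2 * (a - m * (1 + a)))) / (2 * b * D * D)"
    by (simp only: times_divide_eq_right times_divide_eq_left divide_divide_eq_left mult_ac)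
  also have "\<dots> = q * q * c * \<gamma> * (D + 2 * s\<^sup>2 * (a - m * (1 + a))) / (2 * b * D * D)"
    unfolding q2' by (simp add: power2_eq_square)
  finally have "- (X \<phi> * (\<delta> * Y \<phi> - \<rho>h)) / (\<kappa> * delta_amp \<phi>)
      = q * c * (D + 2 * s\<^sup>2 * (a - m * (1 + a))) / r / (D * D)"
    using pos by (simp add: \<kappa>_def defs[symmetric] mult_ac)
  thus ?thesis using 1 by simp
qed

section \<open>The highest point and the motion along the curve\<close>

lemma sphere: "(X \<phi>)\<^sup>2 + (Y \<phi>)\<^sup>2 + (Z \<phi>)\<^sup>2 = 1"
  and energy_surface: "\<delta> * (Y \<phi>)\<^sup>2 + \<gamma> * (Z \<phi>)\<^sup>2 = 2 * \<rho>h * Y \<phi>"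
proof -
  define s c D where "s = (sin \<phi>)\<^sup>2" and "c = (cos \<phi>)\<^sup>2" and "D = den \<phi>"
  note defs = s_def c_def D_def
  have D0: "0 < D" using den_pos by (simp add: defs)
  have c: "c = 1 - s" by (simp add: defs cos_squared_eq)
  have D: "D = 1 + a * (1 - s)" by (simp add: defs den_def cos_squared_eq)
  have X2: "(X \<phi>)\<^sup>2 = (1 + a)\<^sup>2 * c / D\<^sup>2"
    by (simp add: X_def defs power_mult_distrib power_divide)
  have Y2: "(Y \<phi>)\<^sup>2 = b\<^sup>2 * s\<^sup>2 / D\<^sup>2"
    by (simp add: Y_def defs power_mult_distrib power_divide)
  have "(Z \<phi>)\<^sup>2 = (1 - a\<^sup>2) * s * (1 - m * s) / D\<^sup>2"
    using a2_less_1 by (simp add: Z_def defs power_mult_distrib power_divide delta_amp_sq)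
  also have "(1 - a\<^sup>2) * s * (1 - m * s) = (1 - a\<^sup>2) * s - (m * (1 - a\<^sup>2)) * s\<^sup>2"
    by (simp add: power2_eq_square algebra_simps)
  finally have Z2: "(Z \<phi>)\<^sup>2 = ((1 - a\<^sup>2) * s - (b\<^sup>2 - a\<^sup>2) * s\<^sup>2) / D\<^sup>2"
    unfolding m_eq .
  have "(1 + a)\<^sup>2 * c + b\<^sup>2 * s\<^sup>2 + ((1 - a\<^sup>2) * s - (b\<^sup>2 - a\<^sup>2) * s\<^sup>2) = D\<^sup>2"
    unfolding c D by (simp add: power2_eq_square algebra_simps)
  thus "(X \<phi>)\<^sup>2 + (Y \<phi>)\<^sup>2 + (Z \<phi>)\<^sup>2 = 1"
    using D0 by (simp add: X2 Y2 Z2 add_divide_distrib[symmetric])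
  have "\<delta> * (b\<^sup>2 * s\<^sup>2) + \<gamma> * ((1 - a\<^sup>2) * s - (b\<^sup>2 - a\<^sup>2) * s\<^sup>2)
      = \<gamma> * (1 - a\<^sup>2) * s - ((\<gamma> - \<delta>) * b\<^sup>2) * s\<^sup>2 + \<gamma> * a\<^sup>2 * s\<^sup>2"
    by (simp add: algebra_simps)
  also have "\<dots> = (\<gamma> * (1 - a)) * s * D"
    unfolding gamma_a[symmetric] D by (simp add: power2_eq_square algebra_simps)
  also have "\<dots> = 2 * \<rho>h * b * s * D" unfolding gamma_1a by simp
  finally have "\<delta> * (b\<^sup>2 * s\<^sup>2) + \<gamma> * ((1 - a\<^sup>2) * s - (b\<^sup>2 - a\<^sup>2) * s\<^sup>2) = 2 * \<rho>h * b * s * D" .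
  hence "\<delta> * (Y \<phi>)\<^sup>2 + \<gamma> * (Z \<phi>)\<^sup>2 = 2 * \<rho>h * b * s * D / D\<^sup>2"
    unfolding Y2 Z2 by (simp add: add_divide_distrib[symmetric])
  also have "\<dots> = 2 * \<rho>h * Y \<phi>"
  proof -
    have "Y \<phi> = b * s / D" by (simp add: Y_def defs)
    thus ?thesis using D0 by (simp add: power2_eq_square)
  qed
  finally show "\<delta> * (Y \<phi>)\<^sup>2 + \<gamma> * (Z \<phi>)\<^sup>2 = 2 * \<rho>h * Y \<phi>" .
qed

lemma Y_bounds: "0 \<le> Y \<phi>" "Y \<phi> \<le> b"
proof -
  show "0 \<le> Y \<phi>" using b_pos den_pos[of \<phi>] by (simp add: Y_def)
  have "(sin \<phi>)\<^sup>2 \<le> 1" "0 \<le> a * (cos \<phi>)\<^sup>2" using a_pos by (simp_all add: abs_square_le_1)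
  hence "(sin \<phi>)\<^sup>2 \<le> den \<phi>" by (simp add: den_def)
  thus "Y \<phi> \<le> b" using b_pos den_pos[of \<phi>] by (simp add: Y_def divide_le_eq)
qed

text \<open>On the energy surface \<open>\<gamma> z\<^sup>2 = 2 \<rho>h y - \<delta> y\<^sup>2\<close>, which increases strictly with \<open>y \<in> [0, b]\<close>.\<close>

lemma Z_le: "Z \<phi> \<le> sqrt (1 - b\<^sup>2)"
  and Z_max: "sqrt (1 - b\<^sup>2) \<le> Z \<phi> \<Longrightarrow> X \<phi> = 0 \<and> Y \<phi> = b \<and> Z \<phi> = sqrt (1 - b\<^sup>2)"
proof -
  have b2: "b\<^sup>2 < 1" using b2_less_a a_less_1 by simp
  have Z2: "\<gamma> * (Z \<phi>)\<^sup>2 = 2 * \<rho>h * Y \<phi> - \<delta> * (Y \<phi>)\<^sup>2"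
    using energy_surface[of \<phi>] by simp
  have top: "\<gamma> * (1 - b\<^sup>2) = 2 * \<rho>h * b - \<delta> * b\<^sup>2"
    using b_root by (simp add: algebra_simps)
  have "\<delta> * b\<^sup>2 \<le> \<delta> * (Y \<phi>)\<^sup>2"
    using delta_neg Y_bounds[of \<phi>] by (simp add: power_mono)
  moreover have "2 * \<rho>h * Y \<phi> \<le> 2 * \<rho>h * b"
    using rho_hat_pos Y_bounds[of \<phi>] by simp
  ultimately have gap: "2 * \<rho>h * (b - Y \<phi>) \<le> \<gamma> * (1 - b\<^sup>2) - \<gamma> * (Z \<phi>)\<^sup>2"
    unfolding Z2 top by (simp add: algebra_simps)
  moreover have "0 \<le> 2 * \<rho>h * (b - Y \<phi>)" using rho_hat_pos Y_bounds[of \<phi>] by simp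
  ultimately have "\<gamma> * (Z \<phi>)\<^sup>2 \<le> \<gamma> * (1 - b\<^sup>2)" by linarith
  hence le: "(Z \<phi>)\<^sup>2 \<le> 1 - b\<^sup>2" using gamma_pos by simp
  thus "Z \<phi> \<le> sqrt (1 - b\<^sup>2)" by (rule real_le_rsqrt)
  assume ge: "sqrt (1 - b\<^sup>2) \<le> Z \<phi>"
  have "(sqrt (1 - b\<^sup>2))\<^sup>2 \<le> (Z \<phi>)\<^sup>2" using ge b2 by (intro power_mono) auto
  hence eq: "(Z \<phi>)\<^sup>2 = 1 - b\<^sup>2" using le b2 by simp
  hence "2 * \<rho>h * (b - Y \<phi>) \<le> 0" using gap by simp
  hence Y: "Y \<phi> = b" using rho_hat_pos Y_bounds[of \<phi>] by (simp add: mult_le_0_iff)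
  moreover have "X \<phi> = 0" using sphere[of \<phi>] by (simp add: eq Y)
  moreover have "Z \<phi> = sqrt (1 - b\<^sup>2)" using ge \<open>Z \<phi> \<le> sqrt (1 - b\<^sup>2)\<close> by simp
  ultimately show "X \<phi> = 0 \<and> Y \<phi> = b \<and> Z \<phi> = sqrt (1 - b\<^sup>2)" by simp
qed

definition orbit_point where "orbit_point \<phi> = l *\<^sub>R (vector [X \<phi>, Y \<phi>, Z \<phi>] :: real^3)"
definition top_point where "top_point = l *\<^sub>R (vector [0, b, sqrt (1 - b\<^sup>2)] :: real^3)"

lemma orbit_point_nth [simp]:
  "orbit_point \<phi> $ 1 = l * X \<phi>" "orbit_point \<phi> $ 2 = l * Y \<phi>" "orbit_point \<phi> $ 3 = l * Z \<phi>"
  by (simp_all add: orbit_point_def)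

lemma orbit_point_start_iff:
  "orbit_point \<phi> = vector [l, 0, 0] \<longleftrightarrow> cos \<phi> = 1"
proof
  assume "orbit_point \<phi> = vector [l, 0, 0]"
  hence eq: "orbit_point \<phi> $ i = (vector [l, 0, 0] :: real^3) $ i" for i by simp
  have X: "X \<phi> = 1" and "Y \<phi> = 0" using eq[of 1] eq[of 2] l_pos by simp_all
  hence s: "sin \<phi> = 0" using den_pos[of \<phi>] b_pos by (auto simp: Y_def)
  have "(1 + a) * cos \<phi> = den \<phi>" using X den_pos[of \<phi>] by (simp add: X_def field_simps)
  hence "0 < (1 + a) * cos \<phi>" using den_pos[of \<phi>] by simp
  hence "0 < cos \<phi>" using a_pos by (simp add: zero_less_mult_iff)
  moreover have "(cos \<phi>)\<^sup>2 = 1" using s sin_cos_squared_add[of \<phi>] by simp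
  ultimately show "cos \<phi> = 1" by (auto simp: power2_eq_1_iff)
next
  assume c: "cos \<phi> = 1"
  hence "sin \<phi> = 0" using sin_cos_squared_add[of \<phi>] by simp
  thus "orbit_point \<phi> = vector [l, 0, 0]"
    using c a_pos by (simp add: vec_eq_iff forall_3 X_def Y_def Z_def den_def)
qed

lemma orbit_point_top_iff:
  "orbit_point \<phi> = top_point \<longleftrightarrow> sin \<phi> = 1"
proof
  assume "orbit_point \<phi> = top_point"
  hence eq: "orbit_point \<phi> $ i = top_point $ i" for i by simp
  have X: "X \<phi> = 0" and Z: "Z \<phi> = sqrt (1 - b\<^sup>2)"
    using eq[of 1] eq[of 3] l_pos by (simp_all add: top_point_def)
  have c: "cos \<phi> = 0" using X den_pos[of \<phi>] a_pos by (simp add: X_def)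
  have "0 < Z \<phi>" using Z b2_less_a a_less_1 by simp
  hence "0 < sin \<phi>"
    using den_pos[of \<phi>] delta_amp_pos[of \<phi>] a2_less_1
    by (simp add: Z_def zero_less_divide_iff zero_less_mult_iff)
  moreover have "(sin \<phi>)\<^sup>2 = 1"
    using c sin_cos_squared_add[of \<phi>] by simp
  ultimately show "sin \<phi> = 1" by (auto simp: power2_eq_1_iff)
next
  assume s: "sin \<phi> = 1"
  hence c: "cos \<phi> = 0" using sin_cos_squared_add[of \<phi>] by simp
  have "sqrt (1 - a\<^sup>2) * delta_amp \<phi> = sqrt (1 - b\<^sup>2)"
    using s by (simp add: delta_amp_def real_sqrt_mult[symmetric] one_minus_m)
  thus "orbit_point \<phi> = top_point"
    using s c by (simp add: vec_eq_iff forall_3 top_point_def X_def Y_def Z_def den_def)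
qed

text \<open>Passing from dimensionless angular momentum and time to \<open>L\<close> and \<open>t\<close> multiplies the vector field by
  \<open>l\<^sup>2 / I1\<close>.\<close>

lemma scaled_field:
  "l\<^sup>2 / I1 * (z * ((\<gamma> - \<delta>) * y + \<rho>h)) = l * y * (l * z / I3) - l * z * ((l * y - h) / I2)"
  "l\<^sup>2 / I1 * - (\<gamma> * x * z) = l * z * (l * x / I1) - l * x * (l * z / I3)"
  "l\<^sup>2 / I1 * (x * (\<delta> * y - \<rho>h)) = l * x * ((l * y - h) / I2) - l * y * (l * x / I1)"
proof -
  have I: "0 < I1" "0 < I2" "0 < I3" "0 < l" using inertia inertia_pos l_pos by simp_all
  show "l\<^sup>2 / I1 * (z * ((\<gamma> - \<delta>) * y + \<rho>h)) = l * y * (l * z / I3) - l * z * ((l * y - h) / I2)"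
    using I by (simp add: gamma delta rho_hat_eq field_simps power2_eq_square)
  show "l\<^sup>2 / I1 * - (\<gamma> * x * z) = l * z * (l * x / I1) - l * x * (l * z / I3)"
    using I by (simp add: gamma field_simps power2_eq_square)
  show "l\<^sup>2 / I1 * (x * (\<delta> * y - \<rho>h)) = l * x * ((l * y - h) / I2) - l * y * (l * x / I1)"
    using I by (simp add: delta rho_hat_eq field_simps power2_eq_square)
qed

text \<open>Run through with the phase speed of the tangency lemmas, the curve is a motion from the same initial
  point, and by uniqueness it is \<open>L\<close>. That \<open>\<phi>\<close> has an inverse \<open>\<tau>\<close> turns statements on times into
  statements on phases.\<close>

lemma motion_by_phase:
  assumes L: "rotor_motion I1 I2 I3 h L" and start: "L 0 = vector [l, 0, 0]"
  obtains \<phi> \<tau> :: "real \<Rightarrow> real" where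
    "\<And>t. L t = orbit_point (\<phi> t)" and
    "\<And>t. (\<phi> has_real_derivative - (l / I1 * \<kappa> * delta_amp (\<phi> t))) (at t)" and
    "\<And>x. (\<tau> has_real_derivative - (I1 / (l * \<kappa>) * (1 / delta_amp x))) (at x)" and
    "\<And>x. \<phi> (\<tau> x) = x" and "\<And>t. \<tau> (\<phi> t) = t"
proof -
  let ?f = "\<lambda>x. l / I1 * \<kappa> * delta_amp x"
  have c_pos: "0 < l / I1" using l_pos inertia_pos by simp
  have cont: "isCont ?f x" for x
    using DERIV_isCont[OF delta_amp_deriv] by (intro continuous_intros)
  have pos: "0 < ?f x" for x using c_pos kappa_pos delta_amp_pos by (intro mult_pos_pos)
  have bound: "?f x \<le> l / I1 * \<kappa> * sqrt (1 + \<bar>m\<bar>)" for x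
    unfolding delta_amp_def using mult_pos_pos[OF c_pos kappa_pos]
    by (intro mult_left_mono real_sqrt_le_mono radicand_bounds) simp
  obtain A B where A0: "A 0 = 0"
    and A: "\<And>t. (A has_real_derivative ?f (A t)) (at t)"
    and B: "\<And>x. (B has_real_derivative 1 / ?f x) (at x)"
    and inv: "\<And>x. A (B x) = x" "\<And>t. B (A t) = t"
    using scalar_autonomous_flow[of ?f, OF cont pos bound] by metis
  define \<phi> where "\<phi> t = - A t" for t
  define \<tau> where "\<tau> x = B (- x)" for x
  have even: "delta_amp (- x) = delta_amp x" for x by (simp add: delta_amp_def)
  have phi: "(\<phi> has_real_derivative - ?f (\<phi> t)) (at t)" for t
    unfolding \<phi>_def even by (rule DERIV_minus[OF A])
  have "(\<tau> has_real_derivative - (1 / ?f x)) (at x)" for x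
    using B[of "- x"] unfolding \<tau>_def even by (simp only: DERIV_mirror)
  hence tau: "(\<tau> has_real_derivative - (I1 / (l * \<kappa>) * (1 / delta_amp x))) (at x)" for x
    by simp
  have chain: "((\<lambda>t. l * g (\<phi> t)) has_real_derivative l\<^sup>2 / I1 * v) (at t)"
    if "(g has_real_derivative - v / (\<kappa> * delta_amp (\<phi> t))) (at (\<phi> t))" for g v t
    using DERIV_cmult[OF DERIV_chain2[OF that phi], of l] kappa_pos delta_amp_pos[of "\<phi> t"]
    by (simp add: power2_eq_square mult_ac)
  have "rotor_motion I1 I2 I3 h (\<lambda>t. orbit_point (\<phi> t))"
  proof (rule rotor_motionI)
    fix t
    let ?p = "orbit_point (\<phi> t)"
    show "((\<lambda>t. orbit_point (\<phi> t) $ 1) has_real_derivative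
        ?p $ 2 * (?p $ 3 / I3) - ?p $ 3 * ((?p $ 2 - h) / I2)) (at t)"
      unfolding orbit_point_nth scaled_field(1)[symmetric] by (rule chain[OF X_deriv])
    have "(Y has_real_derivative - (- (\<gamma> * X (\<phi> t) * Z (\<phi> t))) / (\<kappa> * delta_amp (\<phi> t))) (at (\<phi> t))"
      using Y_deriv by simp
    thus "((\<lambda>t. orbit_point (\<phi> t) $ 2) has_real_derivative
        ?p $ 3 * (?p $ 1 / I1) - ?p $ 1 * (?p $ 3 / I3)) (at t)"
      unfolding orbit_point_nth scaled_field(2)[symmetric] by (rule chain)
    show "((\<lambda>t. orbit_point (\<phi> t) $ 3) has_real_derivative
        ?p $ 1 * ((?p $ 2 - h) / I2) - ?p $ 2 * (?p $ 1 / I1)) (at t)"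
      unfolding orbit_point_nth scaled_field(3)[symmetric] by (rule chain[OF Z_deriv])
  qed
  moreover have "orbit_point (\<phi> 0) = vector [l, 0, 0]"
    by (simp add: orbit_point_start_iff \<phi>_def A0)
  ultimately have "L t = orbit_point (\<phi> t)" for t
    using rotor_motion_unique[OF L, of "\<lambda>t. orbit_point (\<phi> t)" t] start by (simp only:)
  moreover have "\<phi> (\<tau> x) = x" "\<tau> (\<phi> t) = t" for x t
    using inv by (simp_all add: \<phi>_def \<tau>_def)
  ultimately show thesis using phi tau that[of \<phi> \<tau>] by blast
qed

definition segment_duration where
  "segment_duration = I1 / (l * \<kappa>) * complete_elliptic_K m"

text \<open>Each quarter turn from \<open>2 pi n\<close> takes the same time, because \<open>delta_amp\<close> has the period \<open>2 pi\<close>. The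
  sign says that the flow traverses it from the highest point to the start.\<close>

lemma quarter_turn_time:
  fixes n :: int
  assumes "\<And>x. (\<tau> has_real_derivative - (I1 / (l * \<kappa>) * (1 / delta_amp x))) (at x)"
  shows "\<tau> (2 * pi * n + pi / 2) - \<tau> (2 * pi * n) = - segment_duration"
proof -
  let ?T = "\<lambda>x. \<tau> (x + 2 * pi * n)"
  have periodic: "delta_amp (x + 2 * pi * n) = delta_amp x" for x
    by (simp add: delta_amp_def sin_add)
  have "(?T has_real_derivative - (I1 / (l * \<kappa>) * (1 / delta_amp x))) (at x within {0..pi / 2})" for x
    using assms[of "x + 2 * pi * n"] unfolding periodic DERIV_shift
    by (rule has_field_derivative_at_within)
  hence "((\<lambda>x. - (I1 / (l * \<kappa>) * (1 / delta_amp x))) has_integral ?T (pi / 2) - ?T 0) {0..pi / 2}"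
    by (intro fundamental_theorem_of_calculus)
      (auto simp: has_real_derivative_iff_has_vector_derivative[symmetric])
  hence "?T (pi / 2) - ?T 0 = integral {0..pi / 2} (\<lambda>x. - (I1 / (l * \<kappa>)) * (1 / delta_amp x))"
    unfolding mult_minus_left[symmetric] by (rule integral_unique[symmetric])
  also have "\<dots> = - (I1 / (l * \<kappa>)) * integral {0..pi / 2} (\<lambda>x. 1 / delta_amp x)"
    by (rule integral_mult_right)
  also have "\<dots> = - segment_duration"
    by (simp add: segment_duration_def complete_elliptic_K_def delta_amp_def)
  finally show ?thesis by (simp add: add.commute)
qed

section \<open>The minimal tilt with the rotor off\<close>

text \<open>At the time of minimal tilt \<open>dz/dt = 0\<close>, so \<open>y = 0\<close> or \<open>x = 0\<close>. If \<open>y = 0\<close>, the energy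
  integral \<open>\<delta> y\<^sup>2 + \<gamma> z\<^sup>2\<close> gives the claim. This integral is positive, equal to \<open>2 \<rho>h b\<close> in units of \<open>l\<^sup>2\<close>; as
  \<open>\<delta> < 0\<close>, \<open>z\<close> never vanishes. The conservation laws make \<open>z\<^sup>2\<close> largest where \<open>x = 0\<close>. A minimum with \<open>x = 0\<close> would
  therefore force \<open>x = 0\<close> throughout, but \<open>dx/dt \<noteq> 0\<close> at the initial point.\<close>

lemma minimal_tilt_rotor_off:
  assumes M: "rotor_motion I1 I2 I3 0 M" and start: "M 0 = top_point"
    and min: "minimal_tilt l M \<alpha>"
  shows "(sin \<alpha>)\<^sup>2 = 1 - a"
proof -
  let ?x = "\<lambda>t. M t $ 1" and ?y = "\<lambda>t. M t $ 2" and ?z = "\<lambda>t. M t $ 3"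
  have I: "0 < I1" "0 < I2" "0 < I3" using inertia inertia_pos by simp_all
  have b2: "b\<^sup>2 < 1" using b2_less_a a_less_1 by simp
  have init: "?x 0 = 0" "?y 0 = l * b" "?z 0 = l * sqrt (1 - b\<^sup>2)"
    unfolding start top_point_def by simp_all
  have norm: "(?x t)\<^sup>2 + (?y t)\<^sup>2 + (?z t)\<^sup>2 = l\<^sup>2" for t
    using rotor_motion_norm[OF M, of t] b2 by (simp add: init power_mult_distrib algebra_simps)
  have scaled: "I1 * (x\<^sup>2 / I1 + y\<^sup>2 / I2 + z\<^sup>2 / I3) = (x\<^sup>2 + y\<^sup>2 + z\<^sup>2) + (\<delta> * y\<^sup>2 + \<gamma> * z\<^sup>2)" for x y z
    using I by (simp add: delta gamma field_simps)
  have energy: "\<delta> * (?y t)\<^sup>2 + \<gamma> * (?z t)\<^sup>2 = l\<^sup>2 * \<gamma> * (1 - a)" for t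
  proof -
    have "(?x t)\<^sup>2 / I1 + (?y t)\<^sup>2 / I2 + (?z t)\<^sup>2 / I3 = (?x 0)\<^sup>2 / I1 + (?y 0)\<^sup>2 / I2 + (?z 0)\<^sup>2 / I3"
      using rotor_motion_energy[OF M, of t] by simp
    hence "\<delta> * (?y t)\<^sup>2 + \<gamma> * (?z t)\<^sup>2 = \<delta> * (?y 0)\<^sup>2 + \<gamma> * (?z 0)\<^sup>2"
      using scaled[of "?x t" "?y t" "?z t"] scaled[of "?x 0" "?y 0" "?z 0"] norm[of t] norm[of 0] by simp
    also have "\<dots> = l\<^sup>2 * (\<gamma> - (\<gamma> - \<delta>) * b\<^sup>2)"
      using b2 by (simp add: init power_mult_distrib algebra_simps)
    also have "\<dots> = l\<^sup>2 * \<gamma> * (1 - a)"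
      unfolding gamma_a[symmetric] by (simp add: algebra_simps)
    finally show ?thesis .
  qed
  have bound: "\<bar>?z t / l\<bar> \<le> 1" for t
  proof -
    have "(?z t)\<^sup>2 \<le> l\<^sup>2" unfolding norm[of t, symmetric] by simp
    hence "\<bar>?z t\<bar> \<le> l" using l_pos abs_le_square_iff[of "?z t" l] by simp
    thus ?thesis using l_pos by simp
  qed
  obtain t0 where \<alpha>: "\<alpha> = tilt l (M t0)" and le: "\<And>t. tilt l (M t0) \<le> tilt l (M t)"
    using min unfolding minimal_tilt_def by auto
  have z_min: "?z t0 \<le> ?z t" for t
    using le[of t] bound l_pos by (simp add: tilt_def arcsin_le_mono divide_le_cancel)
  have "- 1 \<le> ?z t0 / l" "?z t0 / l \<le> 1" using bound[of t0] by linarith+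
  hence sin_\<alpha>: "sin \<alpha> = ?z t0 / l" by (simp add: \<alpha> tilt_def)
  have "?x t0 * ((?y t0 - 0) / I2) - ?y t0 * (?x t0 / I1) = 0"
    using z_min by (intro DERIV_local_min[OF rotor_motion_derivs(3)[OF M] zero_less_one]) blast
  hence "?x t0 * ?y t0 * (1 / I2 - 1 / I1) = 0" by (simp add: algebra_simps)
  moreover have "1 / I2 - 1 / I1 \<noteq> 0" using inertia I by simp
  ultimately consider "?y t0 = 0" | "?x t0 = 0" by auto
  thus ?thesis
  proof cases
    case 1
    hence "\<gamma> * (?z t0)\<^sup>2 = \<gamma> * (l\<^sup>2 * (1 - a))" using energy[of t0] by simp
    hence "(?z t0)\<^sup>2 = l\<^sup>2 * (1 - a)" using gamma_pos by simp
    thus ?thesis using l_pos by (simp add: sin_\<alpha> power_divide)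
  next
    case 2
    have nonzero: "?z t \<noteq> 0" for t
    proof
      assume "?z t = 0"
      hence "\<delta> * (?y t)\<^sup>2 = l\<^sup>2 * \<gamma> * (1 - a)" using energy[of t] by simp
      moreover have "\<delta> * (?y t)\<^sup>2 \<le> 0" using delta_neg by (simp add: mult_nonpos_nonneg)
      moreover have "0 < l\<^sup>2 * \<gamma> * (1 - a)" using l_pos gamma_pos a_less_1 by simp
      ultimately show False by linarith
    qed
    have z0: "0 < ?z 0" using l_pos b2 by (simp add: init)
    have z_pos: "0 < ?z t0"
    proof (rule ccontr)
      assume "\<not> 0 < ?z t0"
      moreover have "continuous_on (closed_segment 0 t0) ?z"
        using rotor_motion_derivs(3)[OF M] by (intro continuous_at_imp_continuous_on ballI DERIV_isCont)
      ultimately obtain t where "?z t = 0"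
        using ivt_closed_segment[of 0 t0 ?z 0] z0 by auto
      thus False using nonzero by simp
    qed
    \<comment> \<open>Eliminating \<open>y\<close> shows, since \<open>\<delta> < 0\<close>, that \<open>z\<^sup>2\<close> is largest where \<open>x = 0\<close>.\<close>
    have split: "(\<gamma> - \<delta>) * (?z t)\<^sup>2 = l\<^sup>2 * (\<gamma> * (1 - a) - \<delta>) + \<delta> * (?x t)\<^sup>2" for t
    proof -
      have "(\<gamma> - \<delta>) * (?z t)\<^sup>2 = (\<delta> * (?y t)\<^sup>2 + \<gamma> * (?z t)\<^sup>2)
          - \<delta> * ((?x t)\<^sup>2 + (?y t)\<^sup>2 + (?z t)\<^sup>2) + \<delta> * (?x t)\<^sup>2"
        by (simp add: algebra_simps)
      thus ?thesis unfolding energy norm by (simp add: algebra_simps)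
    qed
    have x0: "?x t = 0" for t
    proof -
      have "(\<gamma> - \<delta>) * (?z t0)\<^sup>2 \<le> (\<gamma> - \<delta>) * (?z t)\<^sup>2"
        using z_min[of t] z_pos gamma_pos delta_neg by (intro mult_left_mono power_mono) auto
      hence "0 \<le> \<delta> * (?x t)\<^sup>2" using split[of t] split[of t0] 2 by simp
      thus ?thesis using delta_neg by (simp add: zero_le_mult_iff)
    qed
    have "((\<lambda>t. ?x t) has_real_derivative 0) (at 0)" by (simp add: x0)
    from DERIV_unique[OF rotor_motion_derivs(1)[OF M, of 0] this]
    have "?y 0 * ?z 0 * (1 / I3 - 1 / I2) = 0" by (simp add: algebra_simps)
    moreover have "1 / I3 - 1 / I2 \<noteq> 0" using inertia I by simp
    moreover have "?y 0 \<noteq> 0" using l_pos b_pos by (simp add: init)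
    ultimately show ?thesis using z0 by simp
  qed
qed

section \<open>The segment time\<close>

lemma top_angles:
  "tilt l top_point = arcsin (sqrt (1 - b\<^sup>2))"
  "sin (tilt l top_point) = sqrt (1 - b\<^sup>2)"
  "cos (tilt l top_point) = b"
proof -
  have b2: "0 \<le> 1 - b\<^sup>2" "1 - b\<^sup>2 \<le> 1" using b2_less_a a_less_1 by auto
  hence r: "- 1 \<le> sqrt (1 - b\<^sup>2)" "sqrt (1 - b\<^sup>2) \<le> 1"
    by (auto intro: order.trans[OF _ real_sqrt_ge_zero])
  show tilt: "tilt l top_point = arcsin (sqrt (1 - b\<^sup>2))"
    using l_pos by (simp add: tilt_def top_point_def)
  show "sin (tilt l top_point) = sqrt (1 - b\<^sup>2)" unfolding tilt using r by simp
  show "cos (tilt l top_point) = b" unfolding tilt using r b2 b_pos by (simp add: cos_arcsin)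
qed

lemma segment_duration_nonneg: "0 \<le> segment_duration"
proof -
  have "0 \<le> complete_elliptic_K m"
    unfolding complete_elliptic_K_def
    using delta_amp_pos by (cases "(\<lambda>\<alpha>. 1 / sqrt (1 - m * (sin \<alpha>)\<^sup>2)) integrable_on {0..pi / 2}")
      (auto intro!: integral_nonneg simp: delta_amp_def not_integrable_integral less_imp_le)
  thus ?thesis using inertia_pos l_pos kappa_pos by (simp add: segment_duration_def)
qed

lemma scaled_segment_duration:
  "\<gamma> * (l * segment_duration / I1) = 2 * sqrt (b\<^sup>2 / (1 - a\<^sup>2)) * complete_elliptic_K m"
  using inertia_pos l_pos gamma_pos b_pos a2_less_1
  by (simp add: segment_duration_def \<kappa>_def real_sqrt_divide)

end

locale rotor_orbit = rotor_body +
  fixes L :: "real \<Rightarrow> real^3" and \<phi> \<tau> :: "real \<Rightarrow> real"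
  assumes motion_eq: "L t = orbit_point (\<phi> t)"
    and phase_deriv: "(\<phi> has_real_derivative - (l / I1 * \<kappa> * delta_amp (\<phi> t))) (at t)"
    and time_deriv: "(\<tau> has_real_derivative - (I1 / (l * \<kappa>) * (1 / delta_amp x))) (at x)"
    and phase_time [simp]: "\<phi> (\<tau> x) = x" and time_phase [simp]: "\<tau> (\<phi> t) = t"
begin

lemma highest_point_iff: "highest_point l L Q \<longleftrightarrow> Q = top_point"
proof -
  have tilt: "tilt l (orbit_point x) = arcsin (Z x)" for x
    using l_pos by (simp add: tilt_def)
  have Z1: "\<bar>Z x\<bar> \<le> 1" for x
  proof -
    have "(Z x)\<^sup>2 \<le> 1" unfolding sphere[of x, symmetric] by simp
    thus ?thesis by (simp add: abs_square_le_1)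
  qed
  have top: "orbit_point (pi / 2) = top_point" by (simp add: orbit_point_top_iff)
  have top_Z: "Z (pi / 2) = sqrt (1 - b\<^sup>2)"
    using arg_cong[OF top, of "\<lambda>v. v $ 3"] l_pos by (simp add: top_point_def)
  have at_top: "L (\<tau> (pi / 2)) = top_point" by (simp add: motion_eq top)
  have "tilt l (L t) \<le> tilt l top_point" for t
    unfolding motion_eq top[symmetric] tilt
    by (rule iffD2[OF arcsin_le_mono[OF Z1 Z1]]) (simp add: top_Z Z_le)
  hence "highest_point l L top_point"
    using at_top unfolding highest_point_def by (metis rangeI)
  moreover have "Q = top_point" if highest: "highest_point l L Q"
  proof -
    obtain t where t: "Q = L t" "\<And>t'. tilt l (L t') \<le> tilt l (L t)"
      using highest unfolding highest_point_def by auto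
    have "arcsin (Z (pi / 2)) \<le> arcsin (Z (\<phi> t))"
      using t(2)[of "\<tau> (pi / 2)"] unfolding motion_eq tilt by simp
    hence "Z (pi / 2) \<le> Z (\<phi> t)" by (rule iffD1[OF arcsin_le_mono[OF Z1 Z1]])
    hence "sqrt (1 - b\<^sup>2) \<le> Z (\<phi> t)" by (simp add: top_Z)
    from Z_max[OF this] show ?thesis
      unfolding t motion_eq orbit_point_def top_point_def by simp
  qed
  ultimately show ?thesis by blast
qed

lemma phase_antimono:
  assumes "s \<le> t"
  shows "\<phi> t \<le> \<phi> s"
proof (rule DERIV_nonpos_imp_nonincreasing[OF assms])
  fix x
  have "0 < l / I1 * \<kappa> * delta_amp (\<phi> x)"
    using l_pos inertia_pos kappa_pos delta_amp_pos by simp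
  thus "\<exists>d. (\<phi> has_real_derivative d) (at x) \<and> d \<le> 0"
    using phase_deriv[of x] by (intro exI conjI) auto
qed

text \<open>The angles are recovered from the point by \<open>sin \<theta> = - y\<close> and \<open>cos \<psi> = x / sqrt (1 - y\<^sup>2)\<close>. They are
  continuous because \<open>y \<le> b < 1\<close> keeps the orbit away from the pole of the parametrisation.\<close>

lemma segment_time_if: "segment_time l L top_point segment_duration"
proof -
  let ?S = "closed_segment (\<tau> 0) (\<tau> (pi / 2))"
  define \<theta> where "\<theta> t = - arcsin (Y (\<phi> t))" for t
  define \<psi> where "\<psi> t = arccos (X (\<phi> t) / sqrt (1 - (Y (\<phi> t))\<^sup>2))" for t
  have dur: "\<tau> (pi / 2) - \<tau> 0 = - segment_duration"
    using quarter_turn_time[OF time_deriv, of 0] by simp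
  have phase: "0 \<le> \<phi> t \<and> \<phi> t \<le> pi / 2" if "t \<in> ?S" for t
    using that dur segment_duration_nonneg phase_antimono[of t "\<tau> 0"] phase_antimono[of "\<tau> (pi / 2)" t]
    by (auto simp: closed_segment_eq_real_ivl split: if_splits)
  have Y1: "\<bar>Y x\<bar> \<le> 1" "0 < 1 - (Y x)\<^sup>2" for x
    using Y_bounds[of x] b_less_1 by (auto simp: abs_square_less_1)
  have XR: "\<bar>X x / sqrt (1 - (Y x)\<^sup>2)\<bar> \<le> 1" for x
  proof -
    have "(X x)\<^sup>2 \<le> 1 - (Y x)\<^sup>2" using sphere[of x] zero_le_power2[of "Z x"] by linarith
    hence "\<bar>X x\<bar> \<le> sqrt (1 - (Y x)\<^sup>2)" by (intro real_le_rsqrt) simp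
    thus ?thesis using Y1[of x] by simp
  qed
  have cont: "isCont (\<lambda>t. X (\<phi> t)) t" "isCont (\<lambda>t. Y (\<phi> t)) t" for t
    using isCont_o2[OF DERIV_isCont[OF phase_deriv]] DERIV_isCont[OF X_deriv] DERIV_isCont[OF Y_deriv]
    by blast+
  have Y2: "-1 \<le> Y x" "Y x \<le> 1" for x using Y1(1)[of x] by linarith+
  have XR2: "-1 \<le> X x / sqrt (1 - (Y x)\<^sup>2)" "X x / sqrt (1 - (Y x)\<^sup>2) \<le> 1" for x
    using XR[of x] by linarith+
  have cont_on: "continuous_on ?S (\<lambda>t. X (\<phi> t))" "continuous_on ?S (\<lambda>t. Y (\<phi> t))"
    using cont by (auto intro: continuous_at_imp_continuous_on)
  have "continuous_on ?S \<theta>"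
    unfolding \<theta>_def[abs_def] using Y2 by (intro continuous_intros cont_on) auto
  moreover have "continuous_on ?S \<psi>"
    unfolding \<psi>_def[abs_def] using XR2 Y1(2) by (intro continuous_intros cont_on) (auto simp: less_imp_neq[symmetric])
  moreover have "\<theta> (\<tau> 0) = 0" "\<psi> (\<tau> 0) = 0" "\<psi> (\<tau> (pi / 2)) = pi / 2"
    using a_pos by (simp_all add: \<theta>_def \<psi>_def X_def Y_def den_def)
  moreover have "0 \<le> \<psi> t \<and> \<psi> t \<le> pi / 2 \<and> L t = tilde_param l (\<theta> t) (\<psi> t)" if "t \<in> ?S" for t
  proof -
    let ?x = "\<phi> t" and ?R = "sqrt (1 - (Y (\<phi> t))\<^sup>2)"
    have R: "0 < ?R" using Y1 by simp
    have X0: "0 \<le> X ?x" and Z0: "0 \<le> Z ?x"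
      using phase[OF that] a_pos den_pos[of ?x] delta_amp_pos[of ?x] a2_less_1
      by (auto simp: X_def Z_def intro!: divide_nonneg_pos mult_nonneg_nonneg cos_ge_zero sin_ge_zero)
    have "arccos (X ?x / ?R) \<le> arccos 0"
      using X0 R XR2 by (intro arccos_le_arccos) auto
    hence "0 \<le> \<psi> t \<and> \<psi> t \<le> pi / 2" using XR2 by (simp add: \<psi>_def arccos_lbound)
    moreover have "sin (\<psi> t) = Z ?x / ?R"
    proof -
      have "(Z ?x / ?R)\<^sup>2 = 1 - (X ?x / ?R)\<^sup>2"
        using sphere[of ?x] Y1(2)[of ?x] by (simp add: power_divide field_simps)
      hence "sqrt (1 - (X ?x / ?R)\<^sup>2) = Z ?x / ?R"
        using Z0 R by (metis real_sqrt_unique divide_nonneg_pos)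
      thus ?thesis using XR2[of ?x] by (simp add: \<psi>_def sin_arccos)
    qed
    ultimately show ?thesis
      using R XR2[of ?x] Y2[of ?x]
      by (simp add: motion_eq orbit_point_def tilde_param_def \<theta>_def \<psi>_def cos_arcsin)
  qed
  moreover have "segment_duration = \<bar>\<tau> (pi / 2) - \<tau> 0\<bar>" using dur segment_duration_nonneg by simp
  moreover have "L (\<tau> (pi / 2)) = top_point" by (simp add: motion_eq orbit_point_top_iff)
  ultimately show ?thesis unfolding segment_time_def by blast
qed

text \<open>The orbit avoids the pole of the parametrisation, so \<open>cos \<theta>\<close> keeps its initial sign, and
  \<open>\<psi> \<in> [0, pi / 2]\<close> implies \<open>x \<ge> 0\<close>. The phase then cannot pass a point with \<open>cos \<phi> = - 1\<close>. This confines the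
  segment to within a half turn of its start, where there is only one phase with \<open>sin \<phi> = 1\<close>.\<close>

lemma segment_time_unique:
  assumes "segment_time l L top_point T"
  shows "T = segment_duration"
proof -
  obtain t0 t1 \<theta> \<psi> where T: "T = \<bar>t1 - t0\<bar>" and top: "L t1 = top_point"
    and cont: "continuous_on (closed_segment t0 t1) \<theta>"
    and init: "\<theta> t0 = 0" "\<psi> t0 = 0"
    and seg: "\<And>t. t \<in> closed_segment t0 t1 \<Longrightarrow>
        0 \<le> \<psi> t \<and> \<psi> t \<le> pi / 2 \<and> L t = tilde_param l (\<theta> t) (\<psi> t)"
    using assms unfolding segment_time_def by blast
  have cos_pos: "0 < cos (\<theta> t)" if t: "t \<in> closed_segment t0 t1" for t
  proof (rule ccontr)
    assume "\<not> 0 < cos (\<theta> t)"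
    moreover have sub: "closed_segment t0 t \<subseteq> closed_segment t0 t1"
      using t by (simp add: subset_closed_segment)
    have "continuous_on (closed_segment t0 t) (\<lambda>t. cos (\<theta> t))"
      using continuous_on_subset[OF cont sub] by (intro continuous_intros)
    ultimately obtain s where s: "s \<in> closed_segment t0 t" "cos (\<theta> s) = 0"
      using ivt_closed_segment[of t0 t "\<lambda>t. cos (\<theta> t)" 0] init by auto
    have "orbit_point (\<phi> s) = tilde_param l (\<theta> s) (\<psi> s)" using seg[of s] s(1) sub motion_eq by auto
    hence "orbit_point (\<phi> s) $ i = tilde_param l (\<theta> s) (\<psi> s) $ i" for i by simp
    from this[of 2] have "l * Y (\<phi> s) = l * - sin (\<theta> s)" by (simp add: tilde_param_def)
    hence "Y (\<phi> s) = - sin (\<theta> s)" using l_pos unfolding mult_cancel_left by simp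
    moreover have "(sin (\<theta> s))\<^sup>2 = 1" using s(2) sin_cos_squared_add[of "\<theta> s"] by simp
    ultimately have "(Y (\<phi> s))\<^sup>2 = 1" by simp
    thus False using Y_bounds[of "\<phi> s"] b_less_1 by (auto simp: power2_eq_1_iff)
  qed
  have quadrant: "0 \<le> cos (\<phi> t)" if t: "t \<in> closed_segment t0 t1" for t
  proof -
    have "orbit_point (\<phi> t) $ i = tilde_param l (\<theta> t) (\<psi> t) $ i" for i
      using seg[OF t] motion_eq by simp
    from this[of 1] have "X (\<phi> t) = cos (\<theta> t) * cos (\<psi> t)"
      using l_pos by (simp add: tilde_param_def)
    moreover have "0 \<le> cos (\<psi> t)" using seg[OF t] by (intro cos_ge_zero) auto
    ultimately have "0 \<le> X (\<phi> t)" using cos_pos[OF t] by simp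
    thus ?thesis using den_pos[of "\<phi> t"] a_pos by (simp add: X_def zero_le_divide_iff zero_le_mult_iff)
  qed
  have "orbit_point (\<phi> t0) = vector [l, 0, 0]"
    using seg[of t0] init by (simp add: motion_eq tilde_param_def vec_eq_iff forall_3)
  hence "cos (\<phi> t0) = 1" by (simp add: orbit_point_start_iff)
  then obtain n :: int where n: "\<phi> t0 = 2 * pi * n"
    using cos_one_2pi_int[of "\<phi> t0"] by (auto simp: mult_ac)
  \<comment> \<open>\<open>d\<close> is the phase difference between the end points of the segment.\<close>
  define d where "d = \<phi> t1 - 2 * pi * n"
  have "sin (\<phi> t1) = 1" using top by (simp add: motion_eq orbit_point_top_iff)
  moreover have "sin (\<phi> t1) = sin (d + 2 * pi * n)" by (simp add: d_def)
  ultimately have sin_d: "sin d = 1" by (simp add: sin_add)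
  have phase_cont: "continuous_on (closed_segment t0 t1) \<phi>"
    by (intro continuous_at_imp_continuous_on ballI DERIV_isCont[OF phase_deriv])
  have d_bounds: "- pi < d" "d < pi"
  proof -
    have no_cross: False if x: "x = 2 * pi * n + pi \<and> pi \<le> d \<or> x = 2 * pi * n - pi \<and> d \<le> - pi" for x
    proof -
      have "\<phi> t0 \<le> x \<and> x \<le> \<phi> t1 \<or> \<phi> t1 \<le> x \<and> x \<le> \<phi> t0"
        using x n by (auto simp: d_def)
      then obtain t where "t \<in> closed_segment t0 t1" "\<phi> t = x"
        using ivt_closed_segment[OF phase_cont] by blast
      moreover have "cos x = - 1" using x by (auto simp: cos_add cos_diff)
      ultimately show False using quadrant by force
    qed
    show "- pi < d" by (rule ccontr, rule no_cross[of "2 * pi * n - pi"]) simp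
    show "d < pi" by (rule ccontr, rule no_cross[of "2 * pi * n + pi"]) simp
  qed
  have "0 \<le> d"
  proof (rule ccontr)
    assume "\<not> 0 \<le> d"
    hence "0 < sin (- d)" using d_bounds by (intro sin_gt_zero) auto
    thus False using sin_d by simp
  qed
  moreover have "cos d = 0" using sin_d sin_cos_squared_add[of d] by simp
  ultimately have "d = pi / 2" using d_bounds arccos_cos[of d] by simp
  hence "\<phi> t1 = 2 * pi * n + pi / 2" by (simp add: d_def)
  hence "t1 - t0 = - segment_duration"
    using quarter_turn_time[OF time_deriv, of n] n time_phase[of t0] time_phase[of t1] by simp
  thus ?thesis using T segment_duration_nonneg by simp
qed

end

theorem lemma11:
  fixes I1 I2 I3 l h \<delta> \<gamma> \<rho> \<rho>h \<nu> :: real and L :: "real \<Rightarrow> real^3"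
  assumes inertia: "0 < I3" "I3 < I1" "I1 < I2"
    and l_pos: "0 < l" and h_pos: "0 < h"
    and delta: "\<delta> = I1 / I2 - 1" and gamma: "\<gamma> = I1 / I3 - 1"
    and rho: "\<rho> = h / l" and rho_hat: "\<rho>h = \<rho> * (1 + \<delta>)"
    and nu: "\<nu> = \<delta> / \<gamma>"
    and motion: "rotor_motion I1 I2 I3 h L" and start: "L 0 = vector [l, 0, 0]"
  shows "(\<forall>t. scaled_energy I1 I2 I3 h l (L t) = 1 / 2 * (1 + \<rho> * \<rho>h)) \<and>
    (\<exists>P \<theta>max \<theta>tmax T2 T2_hat.
       (\<forall>Q. highest_point l L Q \<longleftrightarrow> Q = P) \<and>
       P = l *\<^sub>R vector [0, - sin \<theta>tmax, cos \<theta>tmax] \<and>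
       \<theta>max = tilt l P \<and>
       - sqrt (1 - (sin \<theta>max)\<^sup>2) = - cos \<theta>max \<and>
       - cos \<theta>max = sin \<theta>tmax \<and>
       sin \<theta>tmax = (\<rho>h - sqrt (\<rho>h\<^sup>2 + \<gamma> * (\<gamma> - \<delta>))) / (\<gamma> - \<delta>) \<and>
       (\<forall>T. segment_time l L P T \<longleftrightarrow> T = T2) \<and>
       T2_hat = l * T2 / I1 \<and>
       (\<forall>Loff \<theta>min. rotor_motion I1 I2 I3 0 Loff \<and> Loff 0 = P \<and> minimal_tilt l Loff \<theta>min \<longrightarrow>
          (let s = sin \<theta>min;
               w = s\<^sup>2 * (1 - \<nu>) + \<nu>;
               k2 = (1 / s\<^sup>2 - 1) * w / ((2 - s\<^sup>2) * (1 - \<nu>));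
               k = csqrt (complex_of_real k2)
           in w \<noteq> 0 \<longrightarrow>
              complex_of_real (\<gamma> * T2_hat) =
                2 * k / csqrt (complex_of_real w) * complex_of_real (complete_elliptic_K k2))))"
proof -
  interpret rotor_body I1 I2 I3 l h \<delta> \<gamma> \<rho> \<rho>h \<nu>
    by unfold_locales (fact inertia l_pos h_pos delta gamma rho rho_hat nu)+
  obtain \<phi> \<tau> where "\<And>t. L t = orbit_point (\<phi> t)"
    and "\<And>t. (\<phi> has_real_derivative - (l / I1 * \<kappa> * delta_amp (\<phi> t))) (at t)"
    and "\<And>x. (\<tau> has_real_derivative - (I1 / (l * \<kappa>) * (1 / delta_amp x))) (at x)"
    and "\<And>x. \<phi> (\<tau> x) = x" and "\<And>t. \<tau> (\<phi> t) = t"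
    using motion_by_phase[OF motion start] by metis
  then interpret rotor_orbit I1 I2 I3 l h \<delta> \<gamma> \<rho> \<rho>h \<nu> L \<phi> \<tau>
    by unfold_locales
  have energy: "scaled_energy I1 I2 I3 h l (L t) = 1 / 2 * (1 + \<rho> * \<rho>h)" for t
  proof -
    have "scaled_energy I1 I2 I3 h l (L t)
        = I1 / (2 * l\<^sup>2) * ((L t $ 1)\<^sup>2 / I1 + (L t $ 2 - h)\<^sup>2 / I2 + (L t $ 3)\<^sup>2 / I3)"
      by (simp add: scaled_energy_def inv_inertia_def rotor_momentum_def inner_vec_def sum_3
          power2_eq_square)
    also have "\<dots> = I1 / (2 * l\<^sup>2) * (l\<^sup>2 / I1 + h\<^sup>2 / I2)"
      unfolding rotor_motion_energy[OF motion, of t] start by simp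
    also have "\<dots> = 1 / 2 * (1 + \<rho> * \<rho>h)"
      unfolding rho_hat_eq rho using inertia_pos l_pos by (simp add: field_simps power2_eq_square)
    finally show ?thesis .
  qed
  define \<theta> where "\<theta> = - arcsin b"
  have sin_\<theta>: "sin \<theta> = - b" and cos_\<theta>: "cos \<theta> = sqrt (1 - b\<^sup>2)"
    using b_pos b_less_1 by (simp_all add: \<theta>_def cos_arcsin)
  have top_eq: "top_point = l *\<^sub>R vector [0, - sin \<theta>, cos \<theta>]"
    by (simp add: top_point_def sin_\<theta> cos_\<theta>)
  have cos_tilt: "- sqrt (1 - (sin (tilt l top_point))\<^sup>2) = - cos (tilt l top_point)"
    using top_angles b_pos b2_less_a a_less_1 by simp
  have tilt_\<theta>: "- cos (tilt l top_point) = sin \<theta>" by (simp add: top_angles(3) sin_\<theta>)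
  have root: "sin \<theta> = (\<rho>h - sqrt (\<rho>h\<^sup>2 + \<gamma> * (\<gamma> - \<delta>))) / (\<gamma> - \<delta>)"
    unfolding sin_\<theta> b_def by (simp add: minus_divide_left)
  have duration: "segment_time l L top_point T \<longleftrightarrow> T = segment_duration" for T
    using segment_time_if segment_time_unique by blast
  have elliptic: "complex_of_real (\<gamma> * (l * segment_duration / I1)) =
      2 * csqrt (complex_of_real k2) / csqrt (complex_of_real w) * complex_of_real (complete_elliptic_K k2)"
    if off: "rotor_motion I1 I2 I3 0 Loff" "Loff 0 = top_point" "minimal_tilt l Loff \<theta>min"
      and w_def: "w = (sin \<theta>min)\<^sup>2 * (1 - \<nu>) + \<nu>"
      and k2_def: "k2 = (1 / (sin \<theta>min)\<^sup>2 - 1) * w / ((2 - (sin \<theta>min)\<^sup>2) * (1 - \<nu>))"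
      and "w \<noteq> 0" for Loff \<theta>min w k2
  proof -
    have s2: "(sin \<theta>min)\<^sup>2 = 1 - a" by (rule minimal_tilt_rotor_off[OF off])
    have nz: "1 - a \<noteq> 0" "1 + a \<noteq> 0" "1 - \<nu> \<noteq> 0" "1 - a\<^sup>2 \<noteq> 0"
      using a_pos a_less_1 nu_neg a2_less_1 by simp_all
    have w: "w = 1 - a * (1 - \<nu>)" unfolding w_def s2 by (simp add: algebra_simps)
    have "k2 = w * (a / (1 - \<nu>) / ((1 - a) * (1 + a)))"
      unfolding k2_def s2 using nz by (simp add: field_simps)
    also have "a / (1 - \<nu>) = b\<^sup>2" using nz by (simp add: a_def)
    also have "(1 - a) * (1 + a) = 1 - a\<^sup>2" by (simp add: power2_eq_square algebra_simps)
    finally have k2: "k2 = w * (b\<^sup>2 / (1 - a\<^sup>2))" .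
    have "w * b\<^sup>2 = b\<^sup>2 - a * ((1 - \<nu>) * b\<^sup>2)" unfolding w by (simp add: algebra_simps)
    also have "\<dots> = b\<^sup>2 - a\<^sup>2" unfolding a_def[symmetric] by (simp add: power2_eq_square)
    finally have "k2 = m" by (simp add: k2 m_def)
    moreover have "csqrt (complex_of_real k2) = csqrt (complex_of_real w) * sqrt (b\<^sup>2 / (1 - a\<^sup>2))"
      unfolding k2 using a2_less_1 by (intro csqrt_of_real_mult_nonneg) simp
    ultimately show ?thesis
      using \<open>w \<noteq> 0\<close> unfolding scaled_segment_duration by simp
  qed
  show ?thesis
    unfolding Let_def
  proof (rule conjI[OF allI[OF energy]], rule exI[of _ top_point],
      rule exI[of _ "tilt l top_point"], rule exI[of _ \<theta>], rule exI[of _ segment_duration],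
      rule exI[of _ "l * segment_duration / I1"], intro conjI allI impI)
  qed (fact highest_point_iff top_eq cos_tilt tilt_\<theta> root duration refl | elim conjE, rule elliptic, (assumption | rule refl)+)+
qed

end
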